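(* Let $\mathcal{M}$ be a Riemannian manifold, $f\colon\mathcal{M}\to\mathbb{R}$ be $C^2$, $\mathrm{R}$ a retraction on $\mathcal{M}$, $\mathcal{S}$ the set of local minima of $f$, and let $\bar x\in\mathcal{S}$ be such that the Polyak--Łojasiewicz condition holds around $\bar x$ (with some constant $\mu>0$). Suppose there is $L_H'\ge 0$ such that $f(\mathrm{R}_x(s))-f(x)-\langle s,\nabla f(x)\rangle-\frac12\langle s,\nabla^2 f(x)[s]\rangle\le\frac{L_H'}{6}\|s\|^3$ for all $x$ sufficiently close to $\bar x$ and all sufficiently small $s\in\mathrm{T}_x\mathcal{M}$. Fix constants $\beta_H\ge0$, $c_0>0$, $c_1\ge0$ and a neighborhood $\mathcal{W}$ of $\bar x$. Consider runs of the trust-region algorithm TR with symmetric maps $H_k$ and steps $s_k$ satisfying: (i) $\|H_k-\nabla^2 f(x_k)\|\le\beta_H\|\nabla f(x_k)\|$ whenever $x_k\in\mathcal{W}$; (ii) for all $k$, $m_k(0)-m_k(s_k)\ge c_0\|\nabla f(x_k)\|\min\Big(\Delta_k,\frac{\|\nabla f(x_k)\|^3}{|\langle\nabla f(x_k),H_k[\nabla f(x_k)]\rangle|}\Big)$; (iii) $\|s_k\|\le c_1\|\nabla f(x_k)\|$ whenever $x_k\in\mathcal{W}$. Given a neighborhood $\mathcal{U}$ of $\bar x$, there exists a neighborhood $\mathcal{V}\subseteq\mathcal{U}$ of $\bar x$ such that for every such run, if an iterate of TR enters $\mathcal{V}$, then all the subsequent iterates stay in $\mathcal{U}$ and the sequence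 $(x_k)$ converges to some point $x_\infty\in\mathcal{U}\cap\mathcal{S}$.
   Context: Notation: $\mathrm{T}_x\mathcal{M}$ is the tangent space, with Riemannian inner product $\langle\cdot,\cdot\rangle$ and norm $\|\cdot\|$ (operator norm for linear maps); $\nabla f,\nabla^2 f$ are the Riemannian gradient and Hessian. A retraction is a smooth map $\mathrm{R}\colon\mathrm{T}\mathcal{M}\to\mathcal{M}$, $(x,s)\mapsto\mathrm{R}_x(s)$, with $\mathrm{R}_x(0)=x$ and $\mathrm{D}\mathrm{R}_x(0)=I$ for all $x$. Polyak--Łojasiewicz condition with constant $\mu>0$ around $\bar x$: $f(x)-f(\bar x)\le\frac{1}{2\mu}\|\nabla f(x)\|^2$ for all $x$ in some neighborhood of $\bar x$. TR algorithm: parameters $\rho'\in(0,\frac14)$ and $\bar\Delta>0$ are fixed. Starting from $x_0\in\mathcal{M}$ and $\Delta_0>0$, at iteration $k$ choose a symmetric linear map $H_k$ on $\mathrm{T}_{x_k}\mathcal{M}$ and let $m_k(s)=f(x_k)+\langle s,\nabla f(x_k)\rangle+\frac12\langle s,H_k[s]\rangle$. A subproblem solver returns $s_k\in\mathrm{T}_{x_k}\mathcal{M}$ with $\|s_k\|\le\Delta_k$. Let $\rho_k=\frac{f(x_k)-f(\mathrm{R}_{x_k}(s_k))}{m_k(0)-m_k(s_k)}$ ($\rho_k=1$ if the denominator is zero). Set $x_{k+1}=\mathrm{R}_{x_k}(s_k)$ if $\rho_k>\rho'$ and $x_{k+1}=x_k$ otherwise; set $\Delta_{k+1}=\frac14\Delta_k$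 if $\rho_k<\frac14$, $\Delta_{k+1}=\min(2\Delta_k,\bar\Delta)$ if $\rho_k>\frac34$ and $\|s_k\|=\Delta_k$, and $\Delta_{k+1}=\Delta_k$ otherwise. In (ii), the fraction is understood as $+\infty$ when its denominator is zero (so the right-hand side is $0$ when $\nabla f(x_k)=0$). *)

theory Defs
  imports "HOL-Analysis.Analysis"
begin

section \<open>Maps of class \<open>C\<^sup>k\<close> on open subsets of Euclidean spaces\<close>

fun Ck_on :: "nat \<Rightarrow> ('a::euclidean_space \<Rightarrow> 'b::real_normed_vector) \<Rightarrow> 'a set \<Rightarrow> bool" where
  "Ck_on 0 h S \<longleftrightarrow> continuous_on S h"
| "Ck_on (Suc k) h S \<longleftrightarrow>
     (\<forall>x\<in>S. h differentiable (at x)) \<and> (\<forall>v. Ck_on k (\<lambda>x. frechet_derivative h (at x) v) S)"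

definition smooth_on :: "('a::euclidean_space \<Rightarrow> 'b::real_normed_vector) \<Rightarrow> 'a set \<Rightarrow> bool" where
  "smooth_on h S \<longleftrightarrow> (\<forall>k. Ck_on k h S)"


section \<open>Smooth manifolds\<close>

text \<open>
  The manifold is the whole type \<open>'m\<close>, the model space is \<open>'e\<close>.  A chart is a pair of its domain
  and its coordinate map; values of the coordinate map outside the domain are irrelevant.
\<close>

type_synonym ('m, 'e) chart = "'m set \<times> ('m \<Rightarrow> 'e)"

definition chart_inv :: "('m, 'e) chart \<Rightarrow> 'e \<Rightarrow> 'm" where
  "chart_inv c = inv_into (fst c) (snd c)"

definition is_chart :: "('m::topological_space, 'e::euclidean_space) chart \<Rightarrow> bool" where
  "is_chart c \<longleftrightarrow> open (fst c) \<and> open (snd c ` fst c) \<and>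
     homeomorphism (fst c) (snd c ` fst c) (snd c) (chart_inv c)"

definition smooth_atlas ::
    "('m::{t2_space,second_countable_topology}, 'e::euclidean_space) chart set \<Rightarrow> bool" where
  "smooth_atlas A \<longleftrightarrow>
     (\<forall>c\<in>A. is_chart c) \<and> (\<Union>c\<in>A. fst c) = UNIV \<and>
     (\<forall>c\<in>A. \<forall>d\<in>A. smooth_on (snd d \<circ> chart_inv c) (snd c ` (fst c \<inter> fst d)))"

definition C2_function ::
    "('m, 'e::euclidean_space) chart set \<Rightarrow> ('m \<Rightarrow> real) \<Rightarrow> bool" where
  "C2_function A f \<longleftrightarrow> (\<forall>c\<in>A. Ck_on 2 (f \<circ> chart_inv c) (snd c ` fst c))"


section \<open>Tangent vectors\<close>

text \<open>
  At every point \<open>x\<close> a preferred chart \<open>chart_at A x\<close> of the atlas is selected, and a tangent vector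
  at \<open>x\<close> is represented by its components (an element of \<open>'e\<close>) in that chart.  Thus every tangent
  space is a copy of the vector space \<open>'e\<close>; the norm and inner product of \<open>'e\<close> itself have no
  geometric meaning, and the identification of the tangent spaces at different points need not be
  continuous.  Everything that involves several points therefore goes through \<open>to_chart\<close> and
  \<open>from_chart\<close>, the change of components between the preferred chart at \<open>x\<close> and another chart
  \<open>c\<close> around \<open>x\<close>.
\<close>

definition chart_at :: "('m, 'e) chart set \<Rightarrow> 'm \<Rightarrow> ('m, 'e) chart" where
  "chart_at A x = (SOME c. c \<in> A \<and> x \<in> fst c)"

definition to_chart ::
    "('m, 'e::euclidean_space) chart set \<Rightarrow> ('m, 'e) chart \<Rightarrow> 'm \<Rightarrow> 'e \<Rightarrow> 'e" where
  "to_chart A c x = frechet_derivative (snd c \<circ> chart_inv (chart_at A x)) (at (snd (chart_at A x) x))"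

definition from_chart ::
    "('m, 'e::euclidean_space) chart set \<Rightarrow> ('m, 'e) chart \<Rightarrow> 'm \<Rightarrow> 'e \<Rightarrow> 'e" where
  "from_chart A c x = frechet_derivative (snd (chart_at A x) \<circ> chart_inv c) (at (snd c x))"

definition differential ::
    "('m, 'e::euclidean_space) chart set \<Rightarrow> ('m \<Rightarrow> real) \<Rightarrow> 'm \<Rightarrow> 'e \<Rightarrow> real" where
  "differential A f x = frechet_derivative (f \<circ> chart_inv (chart_at A x)) (at (snd (chart_at A x) x))"


section \<open>Riemannian metrics\<close>

definition metric_in_chart ::
    "('m, 'e::euclidean_space) chart set \<Rightarrow> ('m \<Rightarrow> 'e \<Rightarrow> 'e \<Rightarrow> real) \<Rightarrow>
     ('m, 'e) chart \<Rightarrow> 'e \<Rightarrow> 'e \<Rightarrow> 'e \<Rightarrow> real" where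
  "metric_in_chart A g c y u v =
     g (chart_inv c y) (from_chart A c (chart_inv c y) u) (from_chart A c (chart_inv c y) v)"

definition riemannian_metric ::
    "('m, 'e::euclidean_space) chart set \<Rightarrow> ('m \<Rightarrow> 'e \<Rightarrow> 'e \<Rightarrow> real) \<Rightarrow> bool" where
  "riemannian_metric A g \<longleftrightarrow>
     (\<forall>x. bilinear (g x) \<and> (\<forall>u v. g x u v = g x v u) \<and> (\<forall>v. v \<noteq> 0 \<longrightarrow> 0 < g x v v)) \<and>
     (\<forall>c\<in>A. \<forall>u v. smooth_on (\<lambda>y. metric_in_chart A g c y u v) (snd c ` fst c))"

definition riemannian_manifold ::
    "('m::{t2_space,second_countable_topology}, 'e::euclidean_space) chart set \<Rightarrow>
     ('m \<Rightarrow> 'e \<Rightarrow> 'e \<Rightarrow> real) \<Rightarrow> bool" where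
  "riemannian_manifold A g \<longleftrightarrow> smooth_atlas A \<and> riemannian_metric A g"

definition tnorm :: "('m \<Rightarrow> 'e \<Rightarrow> 'e \<Rightarrow> real) \<Rightarrow> 'm \<Rightarrow> 'e \<Rightarrow> real" where
  "tnorm g x v = sqrt (g x v v)"

text \<open>As in \<^const>\<open>onorm\<close>, the zero vector contributes \<open>0 / 0 = 0\<close>.\<close>

definition tonorm :: "('m \<Rightarrow> 'e \<Rightarrow> 'e \<Rightarrow> real) \<Rightarrow> 'm \<Rightarrow> ('e \<Rightarrow> 'e) \<Rightarrow> real" where
  "tonorm g x T = (SUP v. tnorm g x (T v) / tnorm g x v)"

definition symmetric_map ::
    "('m \<Rightarrow> 'e::real_vector \<Rightarrow> 'e \<Rightarrow> real) \<Rightarrow> 'm \<Rightarrow> ('e \<Rightarrow> 'e) \<Rightarrow> bool" where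
  "symmetric_map g x T \<longleftrightarrow> linear T \<and> (\<forall>u v. g x (T u) v = g x u (T v))"


section \<open>Gradient, Levi-Civita connection, Hessian\<close>

definition rgrad ::
    "('m, 'e::euclidean_space) chart set \<Rightarrow> ('m \<Rightarrow> 'e \<Rightarrow> 'e \<Rightarrow> real) \<Rightarrow> ('m \<Rightarrow> real) \<Rightarrow> 'm \<Rightarrow> 'e" where
  "rgrad A g f x = (THE v. \<forall>w. g x v w = differential A f x w)"

text \<open>
  The Levi-Civita connection in a chart \<open>c\<close>: \<open>christoffel A g c y u v\<close> is the vector
  \<open>\<Sum>\<^sub>i\<^sub>j\<^sub>k \<Gamma>\<^sup>k\<^sub>i\<^sub>j u\<^sup>i v\<^sup>j e\<^sub>k\<close>, determined by torsion-freeness (symmetry in \<open>u, v\<close>) and compatibility with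
  the metric for constant-component vector fields.
\<close>

definition christoffel ::
    "('m, 'e::euclidean_space) chart set \<Rightarrow> ('m \<Rightarrow> 'e \<Rightarrow> 'e \<Rightarrow> real) \<Rightarrow>
     ('m, 'e) chart \<Rightarrow> 'e \<Rightarrow> 'e \<Rightarrow> 'e \<Rightarrow> 'e" where
  "christoffel A g c y = (THE \<Gamma>. bilinear \<Gamma> \<and> (\<forall>u v. \<Gamma> u v = \<Gamma> v u) \<and>
     (\<forall>u v w. frechet_derivative (\<lambda>z. metric_in_chart A g c z v w) (at y) u =
        metric_in_chart A g c y (\<Gamma> u v) w + metric_in_chart A g c y v (\<Gamma> u w)))"

text \<open>
  The covariant derivative at \<open>x\<close> of the vector field \<open>X\<close> in the direction \<open>s\<close>, computed in the
  preferred chart at \<open>x\<close>, in which the components of tangent vectors at \<open>x\<close> are the vectors themselves.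
\<close>

definition cov_deriv ::
    "('m, 'e::euclidean_space) chart set \<Rightarrow> ('m \<Rightarrow> 'e \<Rightarrow> 'e \<Rightarrow> real) \<Rightarrow>
     ('m \<Rightarrow> 'e) \<Rightarrow> 'm \<Rightarrow> 'e \<Rightarrow> 'e" where
  "cov_deriv A g X x s = (let c = chart_at A x in
     frechet_derivative (\<lambda>z. to_chart A c (chart_inv c z) (X (chart_inv c z))) (at (snd c x)) s
     + christoffel A g c (snd c x) s (X x))"

definition rhess ::
    "('m, 'e::euclidean_space) chart set \<Rightarrow> ('m \<Rightarrow> 'e \<Rightarrow> 'e \<Rightarrow> real) \<Rightarrow>
     ('m \<Rightarrow> real) \<Rightarrow> 'm \<Rightarrow> 'e \<Rightarrow> 'e" where
  "rhess A g f = cov_deriv A g (rgrad A g f)"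


section \<open>Retractions\<close>

text \<open>
  Each chart \<open>c\<close> induces the chart \<open>(x, v) \<mapsto> (snd c x, to_chart A c x v)\<close> of the tangent bundle,
  with values in \<open>snd c ` fst c \<times> UNIV\<close>; \<open>bundle_rep A R c\<close> is \<open>R\<close> read in it.  The first two
  conjuncts below say that \<open>R\<close> is continuous and smooth on the tangent bundle.
\<close>

definition bundle_rep ::
    "('m, 'e::euclidean_space) chart set \<Rightarrow> ('m \<Rightarrow> 'e \<Rightarrow> 'm) \<Rightarrow> ('m, 'e) chart \<Rightarrow> 'e \<times> 'e \<Rightarrow> 'm" where
  "bundle_rep A R c = (\<lambda>(y, u). R (chart_inv c y) (from_chart A c (chart_inv c y) u))"

definition is_retraction ::
    "('m::topological_space, 'e::euclidean_space) chart set \<Rightarrow> ('m \<Rightarrow> 'e \<Rightarrow> 'm) \<Rightarrow> bool" where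
  "is_retraction A R \<longleftrightarrow>
     (\<forall>c\<in>A. continuous_on (snd c ` fst c \<times> UNIV) (bundle_rep A R c)) \<and>
     (\<forall>c\<in>A. \<forall>d\<in>A. smooth_on (snd d \<circ> bundle_rep A R c)
        {p \<in> snd c ` fst c \<times> UNIV. bundle_rep A R c p \<in> fst d}) \<and>
     (\<forall>x. R x 0 = x) \<and>
     (\<forall>x. ((\<lambda>s. snd (chart_at A x) (R x s)) has_derivative (\<lambda>s. s)) (at 0))"


section \<open>Optimization\<close>

definition local_minima :: "('m::topological_space \<Rightarrow> real) \<Rightarrow> 'm set" where
  "local_minima f = {x. \<forall>\<^sub>F y in nhds x. f x \<le> f y}"

definition PL_around ::
    "('m::topological_space, 'e::euclidean_space) chart set \<Rightarrow> ('m \<Rightarrow> 'e \<Rightarrow> 'e \<Rightarrow> real) \<Rightarrow>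
     ('m \<Rightarrow> real) \<Rightarrow> real \<Rightarrow> 'm \<Rightarrow> bool" where
  "PL_around A g f \<mu> xbar \<longleftrightarrow>
     (\<forall>\<^sub>F x in nhds xbar. f x - f xbar \<le> 1 / (2 * \<mu>) * (tnorm g x (rgrad A g f x))\<^sup>2)"

definition tr_model ::
    "('m, 'e::euclidean_space) chart set \<Rightarrow> ('m \<Rightarrow> 'e \<Rightarrow> 'e \<Rightarrow> real) \<Rightarrow> ('m \<Rightarrow> real) \<Rightarrow>
     'm \<Rightarrow> ('e \<Rightarrow> 'e) \<Rightarrow> 'e \<Rightarrow> real" where
  "tr_model A g f x H s = f x + g x s (rgrad A g f x) + 1 / 2 * g x s (H s)"

definition tr_ratio ::
    "('m, 'e::euclidean_space) chart set \<Rightarrow> ('m \<Rightarrow> 'e \<Rightarrow> 'e \<Rightarrow> real) \<Rightarrow> ('m \<Rightarrow> real) \<Rightarrow>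
     ('m \<Rightarrow> 'e \<Rightarrow> 'm) \<Rightarrow> 'm \<Rightarrow> ('e \<Rightarrow> 'e) \<Rightarrow> 'e \<Rightarrow> real" where
  "tr_ratio A g f R x H s =
     (let d = tr_model A g f x H 0 - tr_model A g f x H s
      in if d = 0 then 1 else (f x - f (R x s)) / d)"

definition tr_run ::
    "('m, 'e::euclidean_space) chart set \<Rightarrow> ('m \<Rightarrow> 'e \<Rightarrow> 'e \<Rightarrow> real) \<Rightarrow> ('m \<Rightarrow> real) \<Rightarrow>
     ('m \<Rightarrow> 'e \<Rightarrow> 'm) \<Rightarrow> real \<Rightarrow> real \<Rightarrow>
     (nat \<Rightarrow> 'm) \<Rightarrow> (nat \<Rightarrow> real) \<Rightarrow> (nat \<Rightarrow> 'e \<Rightarrow> 'e) \<Rightarrow> (nat \<Rightarrow> 'e) \<Rightarrow> bool" where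
  "tr_run A g f R \<rho>' \<Delta>bar x \<Delta> H s \<longleftrightarrow>
     0 < \<Delta> 0 \<and>
     (\<forall>k. symmetric_map g (x k) (H k) \<and> tnorm g (x k) (s k) \<le> \<Delta> k \<and>
       (let \<rho> = tr_ratio A g f R (x k) (H k) (s k) in
         x (Suc k) = (if \<rho> > \<rho>' then R (x k) (s k) else x k) \<and>
         \<Delta> (Suc k) =
           (if \<rho> < 1 / 4 then 1 / 4 * \<Delta> k
            else if \<rho> > 3 / 4 \<and> tnorm g (x k) (s k) = \<Delta> k then min (2 * \<Delta> k) \<Delta>bar
            else \<Delta> k)))"

end

(* Everything is read in one chart around xbar.  Near xbar the gradient is small, hence so are the
   steps, and the ratio of actual to predicted decrease is at least 1/4: every step is accepted and
   the radius stays bounded away from 0.  Each step s decreases f by at least a multiple of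
   |grad f(x)| |s|, so by the Polyak-Lojasiewicz inequality sqrt (f x - f xbar) drops by at least a
   multiple of |s|.  The path therefore has finite length, bounded by a multiple of
   sqrt (f x - f xbar) at its start, which traps it near xbar and makes it converge; the lower bound
   on the radius forces f to the value f xbar in the limit.

   The only bound needed on the Hessian is |<grad f, Hess f [grad f]>| <= C |grad f|^2 near xbar.
   Although the Hessian at x is computed in a chart depending on x, this follows in a fixed chart,
   because 2 <grad f, Hess f [s]> is the derivative of the scalar function |grad f|^2 along s. *)
theory Submission
  imports Defs
begin

section \<open>Families of inner products\<close>

text \<open>Gradient and Christoffel symbols are given by \<open>THE\<close>, the Hessian by
  \<open>frechet_derivative\<close>; nothing can be said of them before existence is settled, by
  Riesz representation, by the Koszul formula, and by differentiability of the gradient field in a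
  chart. The last point is delicate, since this field is known only as the dual of \<open>df\<close>
  for an inner product that varies with the point. A Hessian bound in the gradient direction
  suffices for the following reason. Along the step \<open>s\<close>, the Taylor inequality contains
  the Hessian and the model contains \<open>H\<close>, so only their difference enters, and that is
  controlled by assumption. The Hessian itself matters in the curvature quotient
  \<open>G ^ 3 / q\<close> of the decrease condition, where \<open>q \<le> K * G^2\<close> bounds
  the quotient below by \<open>G / K\<close>.\<close>

definition spd_form :: "('e::euclidean_space \<Rightarrow> 'e \<Rightarrow> real) \<Rightarrow> bool" where
  "spd_form b \<longleftrightarrow> bilinear b \<and> (\<forall>u v. b u v = b v u) \<and> (\<forall>v. v \<noteq> 0 \<longrightarrow> 0 < b v v)"

text \<open>The constant is a sum of values on basis vectors, so for a family of functionals it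
  inherits continuity in the parameter. Constants of this shape, also for bilinear forms, yield
  bounds that are uniform near a point.\<close>

lemma linear_abs_le:
  fixes \<phi> :: "'e::euclidean_space \<Rightarrow> real"
  assumes "linear \<phi>"
  shows "\<bar>\<phi> u\<bar> \<le> (\<Sum>i\<in>Basis. \<bar>\<phi> i\<bar>) * norm u"
proof -
  have "\<phi> u = (\<Sum>i\<in>Basis. (u \<bullet> i) * \<phi> i)"
    by (subst euclidean_representation[of u, symmetric])
      (simp add: linear_sum[OF assms] linear_scale[OF assms])
  also have "\<bar>\<dots>\<bar> \<le> (\<Sum>i\<in>Basis. \<bar>(u \<bullet> i) * \<phi> i\<bar>)" by (rule sum_abs)
  also have "\<dots> \<le> (\<Sum>i\<in>Basis. norm u * \<bar>\<phi> i\<bar>)"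
    by (intro sum_mono) (simp add: abs_mult Basis_le_norm mult_right_mono)
  finally show ?thesis by (simp add: sum_distrib_left mult.commute)
qed

lemma bilinear_abs_le:
  fixes h :: "'e::euclidean_space \<Rightarrow> 'e \<Rightarrow> real"
  assumes "bilinear h"
  shows "\<bar>h u v\<bar> \<le> (\<Sum>i\<in>Basis. \<Sum>j\<in>Basis. \<bar>h i j\<bar>) * norm u * norm v"
proof -
  have l1: "linear (\<lambda>u. h u v)" and l2: "\<And>u. linear (h u)" for v
    using assms by (auto simp: bilinear_def)
  have "\<bar>h u v\<bar> \<le> (\<Sum>i\<in>Basis. \<bar>h i v\<bar>) * norm u" by (rule linear_abs_le[OF l1])
  also have "\<dots> \<le> (\<Sum>i\<in>Basis. (\<Sum>j\<in>Basis. \<bar>h i j\<bar>) * norm v) * norm u"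
    by (intro mult_right_mono sum_mono linear_abs_le l2) auto
  finally show ?thesis by (simp only: sum_distrib_right[symmetric] mult.assoc mult.commute[of "norm v"])
qed

lemma spd_form_nonneg: "spd_form b \<Longrightarrow> 0 \<le> b v v"
  unfolding spd_form_def by (metis bilinear_lzero less_eq_real_def)

lemma spd_form_eq_0_iff: "spd_form b \<Longrightarrow> b v v = 0 \<longleftrightarrow> v = 0"
  unfolding spd_form_def by (metis bilinear_lzero less_irrefl)

text \<open>On the compact unit sphere the continuous function \<open>b u u\<close> attains a
  minimum, positive by definiteness; homogeneity carries the bound to all vectors.\<close>

lemma spd_form_bounds:
  fixes b :: "'e::euclidean_space \<Rightarrow> 'e \<Rightarrow> real"
  assumes "spd_form b"
  obtains \<kappa> where "\<kappa> > 0" "\<And>u. \<kappa> * (norm u)\<^sup>2 \<le> b u u"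
proof -
  have bl: "bilinear b" and pos: "\<And>v. v \<noteq> 0 \<Longrightarrow> 0 < b v v"
    using assms by (auto simp: spd_form_def)
  have bb: "bounded_bilinear b" using bl by (simp add: bilinear_conv_bounded_bilinear)
  have cont: "continuous_on (sphere 0 1) (\<lambda>u. b u u)"
    by (intro bounded_bilinear.continuous_on[OF bb] continuous_intros)
  obtain i :: 'e where i: "i \<in> Basis" by (meson SOME_Basis)
  then have "sphere (0::'e) 1 \<noteq> {}" by (auto intro!: exI[of _ i])
  then obtain u0 where u0: "u0 \<in> sphere 0 1" "\<And>u. u \<in> sphere 0 1 \<Longrightarrow> b u0 u0 \<le> b u u"
    using continuous_attains_inf[OF compact_sphere _ cont] by blast
  show ?thesis
  proof
    show "b u0 u0 > 0" using u0(1) by (intro pos) auto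
    fix u
    show "b u0 u0 * (norm u)\<^sup>2 \<le> b u u"
    proof (cases "u = 0")
      case True then show ?thesis using bilinear_lzero[OF bl] by simp
    next
      case False
      have "b u0 u0 \<le> b (u /\<^sub>R norm u) (u /\<^sub>R norm u)" using False by (intro u0(2)) simp
      also have "\<dots> = b u u / (norm u)\<^sup>2"
        by (simp add: bilinear_lmul[OF bl] bilinear_rmul[OF bl] power2_eq_square divide_simps)
      finally show ?thesis using False by (simp add: field_simps)
    qed
  qed
qed

lemma spd_form_Cauchy_Schwarz:
  assumes "spd_form b"
  shows "\<bar>b u v\<bar> \<le> sqrt (b u u) * sqrt (b v v)"
proof (cases "v = 0")
  case True
  have bl: "bilinear b" using assms by (auto simp: spd_form_def)
  show ?thesis using True by (simp add: bilinear_rzero[OF bl])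
next
  case False
  have bl: "bilinear b" and sym: "\<And>u v. b u v = b v u" using assms by (auto simp: spd_form_def)
  have p: "b v v > 0" using assms False by (auto simp: spd_form_def)
  \<comment> \<open>The minimiser of the quadratic \<open>b (u - t v) (u - t v)\<close> in
    \<open>t\<close>; nonnegativity of the minimum is the inequality.\<close>
  define t where "t = b u v / b v v"
  have "0 \<le> b (u - t *\<^sub>R v) (u - t *\<^sub>R v)" by (rule spd_form_nonneg[OF assms])
  also have "\<dots> = b u u - 2 * t * b u v + t\<^sup>2 * b v v"
    using sym[of v u]
    by (simp add: bilinear_lsub[OF bl] bilinear_rsub[OF bl] bilinear_lmul[OF bl] bilinear_rmul[OF bl]
        power2_eq_square algebra_simps)
  also have "\<dots> = b u u - (b u v)\<^sup>2 / b v v"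
    using p by (simp add: t_def power2_eq_square field_simps)
  finally have "(b u v)\<^sup>2 \<le> b u u * b v v" using p by (simp add: field_simps)
  then have "\<bar>b u v\<bar> \<le> sqrt (b u u * b v v)" by (metis real_sqrt_abs real_sqrt_le_iff)
  then show ?thesis by (simp add: real_sqrt_mult)
qed

text \<open>\<open>T\<close> expresses \<open>v \<mapsto> b v\<close> in coordinates; definiteness
  makes it injective, hence surjective in finite dimension. This gives the \<open>THE\<close> in
  \<open>rgrad\<close> a value.\<close>

lemma spd_form_Riesz:
  fixes b :: "'e::euclidean_space \<Rightarrow> 'e \<Rightarrow> real"
  assumes b: "spd_form b" and \<phi>: "linear \<phi>"
  shows "\<exists>!v. \<forall>w. b v w = \<phi> w"
proof -
  have bl: "bilinear b" using b by (auto simp: spd_form_def)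
  have lin: "linear (b v)" for v using bl by (simp add: bilinear_def)
  define T where "T = (\<lambda>v. \<Sum>i\<in>Basis. b v i *\<^sub>R i)"
  have T: "linear T"
    unfolding T_def
    by (rule linearI)
      (simp_all add: bilinear_ladd[OF bl] bilinear_lmul[OF bl] scaleR_left_distrib sum.distrib
        scaleR_right.sum)
  have Ti: "T v \<bullet> i = b v i" if "i \<in> Basis" for v i using that by (simp add: T_def)
  have uniq: "v = 0" if "\<forall>w. b v w = 0" for v
    using that spd_form_eq_0_iff[OF b] by blast
  have eqI: "\<forall>w. b v w = \<psi> w" if "linear \<psi>" "\<And>i. i \<in> Basis \<Longrightarrow> b v i = \<psi> i" for v \<psi>
    using linear_eq_on_span[OF lin that(1), of Basis v] that(2) by simp
  have "inj T"
  proof (subst linear_injective_0[OF T], intro allI impI)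
    fix v assume "T v = 0"
    then have "\<forall>w. b v w = (\<lambda>_. 0) w" using Ti[of _ v] by (intro eqI linear_zero) auto
    then show "v = 0" by (intro uniq) auto
  qed
  then have "surj T" using linear_injective_imp_surjective[OF T] by simp
  then obtain v where v: "T v = (\<Sum>i\<in>Basis. \<phi> i *\<^sub>R i)" by (metis surjD)
  then have "\<forall>w. b v w = \<phi> w" using Ti[of _ v] by (intro eqI \<phi>) simp
  moreover have "v' = v" if "\<forall>w. b v' w = \<phi> w" for v'
    using uniq[of "v' - v"] that \<open>\<forall>w. b v w = \<phi> w\<close> by (simp add: bilinear_lsub[OF bl])
  ultimately show ?thesis by blast
qed

lemma spd_form_eqI:
  assumes "spd_form b" "\<And>w. b v w = b v' w"
  shows "v = v'"
proof -
  have bl: "bilinear b" using assms by (auto simp: spd_form_def)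
  have "b (v - v') (v - v') = 0" using assms(2) by (simp add: bilinear_lsub[OF bl])
  then show ?thesis using spd_form_eq_0_iff[OF assms(1)] by simp
qed

text \<open>The constant \<kappa> at \<open>y\<close> survives, halved, once the entries of
  \<open>m z - m y\<close> on basis vectors sum to less than \<open>\<kappa> / 2\<close>;
  bilinearity turns closeness of entries into closeness of forms.\<close>

lemma spd_family_bounds:
  fixes m :: "'a::topological_space \<Rightarrow> 'e::euclidean_space \<Rightarrow> 'e \<Rightarrow> real"
  assumes spd: "spd_form (m y)" and bl: "\<forall>\<^sub>F z in nhds y. bilinear (m z)"
    and cont: "\<And>u v. ((\<lambda>z. m z u v) \<longlongrightarrow> m y u v) (nhds y)"
  obtains \<kappa> where "\<kappa> > 0" "\<forall>\<^sub>F z in nhds y. \<forall>u. \<kappa> * (norm u)\<^sup>2 \<le> m z u u"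
proof -
  obtain \<kappa> where \<kappa>: "\<kappa> > 0" "\<And>u. \<kappa> * (norm u)\<^sup>2 \<le> m y u u"
    using spd_form_bounds[OF spd] by blast
  have bly: "bilinear (m y)" using spd by (simp add: spd_form_def)
  define \<epsilon> where "\<epsilon> z = (\<Sum>i\<in>Basis. \<Sum>j\<in>Basis. \<bar>m z i j - m y i j\<bar>)" for z
  have "(\<epsilon> \<longlongrightarrow> (\<Sum>i\<in>Basis. \<Sum>j\<in>Basis. \<bar>m y i j - m y i j\<bar>)) (nhds y)"
    unfolding \<epsilon>_def by (intro tendsto_intros cont)
  then have "(\<epsilon> \<longlongrightarrow> 0) (nhds y)" by simp
  then have "\<forall>\<^sub>F z in nhds y. \<epsilon> z < \<kappa> / 2" using \<kappa>(1) by (intro order_tendstoD) auto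
  then have "\<forall>\<^sub>F z in nhds y. \<forall>u. \<kappa> / 2 * (norm u)\<^sup>2 \<le> m z u u"
    using bl
  proof eventually_elim
    case (elim z)
    show ?case
    proof
      fix u
      have "bilinear (\<lambda>u v. m z u v - m y u v)"
        using elim(2) bly unfolding bilinear_def by (auto intro: linear_compose_sub)
      from bilinear_abs_le[OF this, of u u]
      have "\<bar>m z u u - m y u u\<bar> \<le> \<epsilon> z * (norm u)\<^sup>2" by (simp add: \<epsilon>_def power2_eq_square mult_ac)
      also have "\<dots> \<le> \<kappa> / 2 * (norm u)\<^sup>2" using elim(1) by (intro mult_right_mono) auto
      finally show "\<kappa> / 2 * (norm u)\<^sup>2 \<le> m z u u" using \<kappa>(2)[of u] by linarith
    qed
  qed
  then show ?thesis using \<kappa>(1) by (intro that[of "\<kappa> / 2"]) auto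
qed

text \<open>Since \<open>p z\<close> is of the order of \<open>norm (z - y)\<close>, replacing
  \<open>r z\<close> by \<open>r y\<close> costs only \<open>o(norm (z - y))\<close>, so continuity
  of \<open>r\<close> suffices.\<close>

lemma has_derivative_mult_zero:
  fixes p r :: "'a::real_normed_vector \<Rightarrow> real"
  assumes p: "(p has_derivative p') (at y)" and p0: "p y = 0" and r: "isCont r y"
  shows "((\<lambda>z. p z * r z) has_derivative (\<lambda>u. p' u * r y)) (at y)"
proof -
  have bl: "bounded_linear p'" using p by (rule has_derivative_bounded_linear)
  from bl obtain K where K: "\<And>u. norm (p' u) \<le> norm u * K" by (metis bounded_linear.bounded)
  define e where "e z = (p z - p' (z - y)) / norm (z - y)" for z
  have e: "(e \<longlongrightarrow> 0) (at y)"
    using p p0 unfolding has_derivative_at_within e_def by (simp add: divide_inverse_commute)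
  have r': "(r \<longlongrightarrow> r y) (at y)" using r by (simp add: isCont_def)
  \<comment> \<open>The remainder quotient splits into the Taylor error of \<open>p\<close> times
    \<open>r\<close>, and the bounded quotient \<open>p' (z - y) / norm (z - y)\<close> times
    \<open>r z - r y\<close>.\<close>
  have "((\<lambda>z. e z * r z + p' (z - y) / norm (z - y) * (r z - r y)) \<longlongrightarrow> 0 * r y + 0) (at y)"
  proof (intro tendsto_add tendsto_mult e r')
    have lim: "((\<lambda>z. K * \<bar>r z - r y\<bar>) \<longlongrightarrow> K * \<bar>r y - r y\<bar>) (at y)" by (intro tendsto_intros r')
    have le: "norm (p' (z - y) / norm (z - y) * (r z - r y)) \<le> K * \<bar>r z - r y\<bar>" for z
    proof (cases "z = y")
      case True then show ?thesis by simp
    next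
      case False
      then have "norm (p' (z - y)) / norm (z - y) \<le> K" using K[of "z - y"] by (simp add: field_simps)
      then have "norm (p' (z - y)) / norm (z - y) * \<bar>r z - r y\<bar> \<le> K * \<bar>r z - r y\<bar>"
        by (intro mult_right_mono) auto
      then show ?thesis by (simp add: abs_mult)
    qed
    show "((\<lambda>z. p' (z - y) / norm (z - y) * (r z - r y)) \<longlongrightarrow> 0) (at y)"
      by (rule Lim_null_comparison[OF always_eventually]) (use le lim in simp_all)
  qed
  then have lim: "((\<lambda>z. e z * r z + p' (z - y) / norm (z - y) * (r z - r y)) \<longlongrightarrow> 0) (at y)" by simp
  have "((\<lambda>z. (1 / norm (z - y)) *\<^sub>R (p z * r z - (p y * r y + p' (z - y) * r y))) \<longlongrightarrow> 0) (at y)"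
  proof (rule Lim_transform_eventually[OF lim])
    show "\<forall>\<^sub>F z in at y. e z * r z + p' (z - y) / norm (z - y) * (r z - r y) =
        (1 / norm (z - y)) *\<^sub>R (p z * r z - (p y * r y + p' (z - y) * r y))"
      unfolding e_def using p0 by (auto simp: diff_divide_distrib algebra_simps eventually_at_filter)
  qed
  moreover have "bounded_linear (\<lambda>u. p' u * r y)"
    by (intro bounded_linear_mult_const bl)
  ultimately show ?thesis unfolding has_derivative_at_within by (simp add: divide_inverse_commute diff_diff_add)
qed

text \<open>Freezing the form at \<open>y\<close> leaves a remainder \<open>(m z b w - m y b w) * (V z \<bullet> b)\<close> whose first
  factor vanishes at \<open>y\<close>, so continuity of \<open>V\<close> is enough for its differentiability.\<close>

lemma dual_vector_differentiable:
  fixes m :: "'a::real_normed_vector \<Rightarrow> 'e::euclidean_space \<Rightarrow> 'e \<Rightarrow> real"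
  assumes spd: "spd_form (m y)" and bl: "\<forall>\<^sub>F z in nhds y. bilinear (m z)"
    and m: "\<And>u v. (\<lambda>z. m z u v) differentiable (at y)"
    and F: "\<And>w. (\<lambda>z. F z w) differentiable (at y)" and linF: "\<forall>\<^sub>F z in nhds y. linear (F z)"
    and V: "\<forall>\<^sub>F z in nhds y. \<forall>w. m z (V z) w = F z w"
  shows "V differentiable (at y)"
proof -
  have bly: "bilinear (m y)" and symy: "\<And>u v. m y u v = m y v u" using spd by (auto simp: spd_form_def)
  have cm: "((\<lambda>z. m z u v) \<longlongrightarrow> m y u v) (nhds y)" for u v
    using differentiable_imp_continuous_within[OF m[of u v]]
    by (simp add: isCont_def tendsto_nhds_iff)
  have cF: "((\<lambda>z. F z w) \<longlongrightarrow> F y w) (nhds y)" for w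
    using differentiable_imp_continuous_within[OF F[of w]]
    by (simp add: isCont_def tendsto_nhds_iff)
  obtain \<kappa> where \<kappa>: "\<kappa> > 0" "\<forall>\<^sub>F z in nhds y. \<forall>u. \<kappa> * (norm u)\<^sup>2 \<le> m z u u"
    using spd_family_bounds[OF spd bl cm] by blast
  define N where "N z = (\<Sum>i\<in>Basis. \<bar>F z i\<bar>)" for z
  have "(N \<longlongrightarrow> N y) (nhds y)" unfolding N_def by (intro tendsto_intros cF)
  then have "\<forall>\<^sub>F z in nhds y. N z < N y + 1" by (intro order_tendstoD) auto
  \<comment> \<open>The regularity of \<open>V\<close> is bootstrapped: boundedness, then
    continuity, then differentiability. Boundedness comes from \<open>\<kappa> |V|^2 \<le> m z (V z)
    (V z) = F z (V z) \<le> N z |V|\<close>.\<close>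
  with \<kappa>(2) linF V have bdV: "\<forall>\<^sub>F z in nhds y. norm (V z) \<le> (N y + 1) / \<kappa>"
  proof eventually_elim
    case (elim z)
    have "\<kappa> * (norm (V z))\<^sup>2 \<le> F z (V z)" using elim by metis
    also have "\<dots> \<le> N z * norm (V z)" using linear_abs_le[OF elim(2), of "V z"] by (simp add: N_def)
    also have "\<dots> \<le> (N y + 1) * norm (V z)" using elim(4) by (intro mult_right_mono) auto
    finally have "\<kappa> * norm (V z) * norm (V z) \<le> (N y + 1) * norm (V z)"
      by (simp add: power2_eq_square mult_ac)
    moreover have "N y + 1 \<ge> 0" unfolding N_def by (simp add: sum_nonneg add_nonneg_nonneg)
    ultimately have "\<kappa> * norm (V z) \<le> N y + 1"
      by (cases "norm (V z) > 0") (auto dest: mult_right_le_imp_le)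
    then show ?case using \<kappa>(1) by (simp add: field_simps)
  qed
  define P where "P = (\<lambda>w z. \<Sum>b\<in>Basis. (m z b w - m y b w) * (V z \<bullet> b))"
  have frozen: "\<forall>\<^sub>F z in nhds y. \<forall>w. m y (V z) w = F z w - P w z"
    using bl V
  proof eventually_elim
    case (elim z)
    show ?case
    proof
      fix w
      have "bilinear (\<lambda>u v. m z u v - m y u v)"
        using elim(1) bly unfolding bilinear_def by (auto intro: linear_compose_sub)
      then have l: "linear (\<lambda>u. m z u w - m y u w)" by (simp add: bilinear_def)
      have "m z (V z) w - m y (V z) w = P w z"
        unfolding P_def
        by (subst (1 2) euclidean_representation[of "V z", symmetric], subst linear_sum[OF l])
          (simp add: linear_scale[OF l] mult.commute)
      then show "m y (V z) w = F z w - P w z" using elim(2) by (simp add: algebra_simps)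
    qed
  qed
  \<comment> \<open>\<open>B i\<close> is dual to the coordinate \<open>i\<close> for the fixed form
    \<open>m y\<close>; testing \<open>frozen\<close> with it isolates that coordinate of
    \<open>V z\<close>.\<close>
  define B where "B i = (THE v. \<forall>w. m y v w = w \<bullet> i)" for i :: 'e
  have B: "m y (B i) w = w \<bullet> i" for i w
    using theI'[OF spd_form_Riesz[OF spd, of "\<lambda>w. w \<bullet> i"]] bounded_linear.linear[OF bounded_linear_inner_left[of i]]
    unfolding B_def by blast
  have rep: "\<forall>\<^sub>F z in nhds y. \<forall>i. V z \<bullet> i = F z (B i) - P (B i) z"
    using frozen by eventually_elim (metis B symy)
  have contV: "isCont V y"
  proof -
    have "((\<lambda>z. V z \<bullet> i) \<longlongrightarrow> F y (B i) - 0) (nhds y)" if "i \<in> Basis" for i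
    proof (rule Lim_transform_eventually)
      show "((\<lambda>z. F z (B i) - P (B i) z) \<longlongrightarrow> F y (B i) - 0) (nhds y)"
      proof (intro tendsto_diff cF)
        have "((\<lambda>z. (m z b (B i) - m y b (B i)) * (V z \<bullet> b)) \<longlongrightarrow> 0) (nhds y)"
          if "b \<in> Basis" for b
        proof (rule Lim_null_comparison)
          show "\<forall>\<^sub>F z in nhds y. norm ((m z b (B i) - m y b (B i)) * (V z \<bullet> b))
              \<le> \<bar>m z b (B i) - m y b (B i)\<bar> * ((N y + 1) / \<kappa>)"
            using bdV
          proof eventually_elim
            case (elim z)
            then have "\<bar>V z \<bullet> b\<bar> \<le> (N y + 1) / \<kappa>" using Basis_le_norm[OF that, of "V z"] by linarith
            then show ?case unfolding real_norm_def abs_mult by (rule mult_left_mono) simp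
          qed
          have "((\<lambda>z. \<bar>m z b (B i) - m y b (B i)\<bar> * ((N y + 1) / \<kappa>)) \<longlongrightarrow>
              \<bar>m y b (B i) - m y b (B i)\<bar> * ((N y + 1) / \<kappa>)) (nhds y)"
            by (intro tendsto_intros cm)
          then show "((\<lambda>z. \<bar>m z b (B i) - m y b (B i)\<bar> * ((N y + 1) / \<kappa>)) \<longlongrightarrow> 0) (nhds y)"
            by simp
        qed
        then show "(P (B i) \<longlongrightarrow> 0) (nhds y)" unfolding P_def by (rule tendsto_null_sum)
      qed
      show "\<forall>\<^sub>F z in nhds y. F z (B i) - P (B i) z = V z \<bullet> i"
        using rep by eventually_elim simp
    qed
    then have "((\<lambda>z. \<Sum>i\<in>Basis. (V z \<bullet> i) *\<^sub>R i) \<longlongrightarrow> (\<Sum>i\<in>Basis. (F y (B i) - 0) *\<^sub>R i)) (nhds y)"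
      by (intro tendsto_intros) auto
    then have "(V \<longlongrightarrow> (\<Sum>i\<in>Basis. (F y (B i) - 0) *\<^sub>R i)) (nhds y)"
      by (simp only: euclidean_representation)
    \<comment> \<open>Convergence along \<open>nhds y\<close> includes the point \<open>y\<close>
      itself, so the limit can only be \<open>V y\<close>.\<close>
    then have "(V \<longlongrightarrow> V y) (nhds y)" using tendsto_nhds_iff by metis
    then show ?thesis by (simp add: isCont_def tendsto_nhds_iff)
  qed
  have "(\<lambda>z. V z \<bullet> i) differentiable (at y)" if "i \<in> Basis" for i
  proof -
    have "(\<lambda>z. (m z b (B i) - m y b (B i)) * (V z \<bullet> b)) differentiable (at y)" for b
    proof -
      obtain D where "((\<lambda>z. m z b (B i)) has_derivative D) (at y)"
        using m[of b "B i"] by (auto simp: differentiable_def)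
      then have "((\<lambda>z. m z b (B i) - m y b (B i)) has_derivative D) (at y)"
        using has_derivative_diff[OF _ has_derivative_const] by fastforce
      then have "((\<lambda>z. (m z b (B i) - m y b (B i)) * (V z \<bullet> b)) has_derivative (\<lambda>u. D u * (V y \<bullet> b))) (at y)"
        by (rule has_derivative_mult_zero) (auto intro!: continuous_intros contV)
      then show ?thesis by (auto simp: differentiable_def)
    qed
    then have "P (B i) differentiable (at y)" unfolding P_def by (intro differentiable_sum) auto
    then have "(\<lambda>z. F z (B i) - P (B i) z) differentiable (at y)" by (intro differentiable_diff F)
    then obtain D where D: "((\<lambda>z. F z (B i) - P (B i) z) has_derivative D) (at y)"
      by (auto simp: differentiable_def)
    have "((\<lambda>z. V z \<bullet> i) has_derivative D) (at y)"
    proof (rule has_derivative_transform_eventually[OF D])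
      show "\<forall>\<^sub>F z in at y. F z (B i) - P (B i) z = V z \<bullet> i"
        using rep by (auto simp: eventually_nhds_conv_at elim: eventually_mono)
      show "F y (B i) - P (B i) y = V y \<bullet> i" using rep by (simp add: eventually_nhds_conv_at)
    qed simp
    then show ?thesis by (auto simp: differentiable_def)
  qed
  then show ?thesis by (subst differentiable_componentwise_within) auto
qed


text \<open>\<open>D u v w\<close> stands for the derivative along \<open>u\<close> of the inner
  product of the constant fields \<open>v\<close> and \<open>w\<close>, so this is the fundamental
  theorem of Riemannian geometry at one point. It gives the \<open>THE\<close> in
  \<open>christoffel\<close> a value.\<close>

lemma Koszul_unique:
  fixes b :: "'e::euclidean_space \<Rightarrow> 'e \<Rightarrow> real" and D :: "'e \<Rightarrow> 'e \<Rightarrow> 'e \<Rightarrow> real"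
  assumes b: "spd_form b"
    and lin: "\<And>v w. linear (\<lambda>u. D u v w)" and bl: "\<And>u. bilinear (D u)"
    and sym: "\<And>u v w. D u v w = D u w v"
  shows "\<exists>!\<Gamma>. bilinear \<Gamma> \<and> (\<forall>u v. \<Gamma> u v = \<Gamma> v u) \<and>
    (\<forall>u v w. D u v w = b (\<Gamma> u v) w + b v (\<Gamma> u w))"
proof (rule ex_ex1I)
  have bb: "bilinear b" and bs: "\<And>u v. b u v = b v u" using b by (auto simp: spd_form_def)
  \<comment> \<open>The Koszul expression; constant fields have vanishing Lie brackets, so only
    derivatives of the metric occur.\<close>
  define T where "T u v w = (D u v w + D v u w - D w u v) / 2" for u v w
  have linT: "linear (T u v)" for u v
    unfolding T_def
    by (rule linearI)
      (simp_all add: linear_add[OF lin] linear_scale[OF lin] bilinear_radd[OF bl] bilinear_rmul[OF bl]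
        field_simps)
  define \<Gamma> where "\<Gamma> u v = (THE x. \<forall>w. b x w = T u v w)" for u v
  have \<Gamma>: "b (\<Gamma> u v) w = T u v w" for u v w
    using theI'[OF spd_form_Riesz[OF b linT[of u v]]] unfolding \<Gamma>_def by blast
  have "bilinear \<Gamma>"
    unfolding bilinear_def
    by (intro conjI allI linearI; rule spd_form_eqI[OF b])
      (simp_all add: bilinear_ladd[OF bb] bilinear_lmul[OF bb] \<Gamma> T_def linear_add[OF lin]
        linear_scale[OF lin] bilinear_radd[OF bl] bilinear_rmul[OF bl] bilinear_ladd[OF bl]
        bilinear_lmul[OF bl] field_simps)
  moreover have "\<Gamma> u v = \<Gamma> v u" for u v
    by (rule spd_form_eqI[OF b]) (simp add: \<Gamma> T_def sym[of _ u v])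
  moreover have "D u v w = b (\<Gamma> u v) w + b v (\<Gamma> u w)" for u v w
    using sym[of u v w] sym[of v u w] sym[of w u v] unfolding bs[of v "\<Gamma> u w"] \<Gamma> T_def
    by (simp add: field_simps)
  ultimately show "\<exists>\<Gamma>. bilinear \<Gamma> \<and> (\<forall>u v. \<Gamma> u v = \<Gamma> v u) \<and>
      (\<forall>u v w. D u v w = b (\<Gamma> u v) w + b v (\<Gamma> u w))"
    by blast
next
  have bs: "\<And>u v. b u v = b v u" using b by (auto simp: spd_form_def)
  fix \<Gamma> \<Gamma>'
  assume 1: "bilinear \<Gamma> \<and> (\<forall>u v. \<Gamma> u v = \<Gamma> v u) \<and> (\<forall>u v w. D u v w = b (\<Gamma> u v) w + b v (\<Gamma> u w))"
    and 2: "bilinear \<Gamma>' \<and> (\<forall>u v. \<Gamma>' u v = \<Gamma>' v u) \<and> (\<forall>u v w. D u v w = b (\<Gamma>' u v) w + b v (\<Gamma>' u w))"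
  \<comment> \<open>Adding the compatibility identities along \<open>u\<close> and \<open>v\<close>
    and subtracting the one along \<open>w\<close> leaves \<open>2 * b (G u v) w\<close>, by
    symmetry of \<open>G\<close>.\<close>
  have *: "b (G u v) w = (D u v w + D v u w - D w u v) / 2"
    if "\<forall>u v. G u v = G v u" "\<forall>u v w. D u v w = b (G u v) w + b v (G u w)" for G u v w
    using that(2)[rule_format, of u v w] that(2)[rule_format, of v u w] that(2)[rule_format, of w u v]
      that(1)[rule_format, of u v] that(1)[rule_format, of u w] that(1)[rule_format, of v w]
      bs[of v "G u w"] bs[of u "G v w"]
    by simp
  show "\<Gamma> = \<Gamma>'"
  proof (intro ext)
    fix u v
    show "\<Gamma> u v = \<Gamma>' u v"
    proof (rule spd_form_eqI[OF b])
      fix w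
      show "b (\<Gamma> u v) w = b (\<Gamma>' u v) w" using *[of \<Gamma> u v w] *[of \<Gamma>' u v w] 1 2 by argo
    qed
  qed
qed


lemma linear_family_derivative:
  fixes F :: "'a::real_normed_vector \<Rightarrow> 'e::euclidean_space \<Rightarrow> real"
  assumes lin: "\<forall>\<^sub>F z in nhds y. linear (F z)"
    and F': "((\<lambda>z. F z (V y)) has_derivative F') (at y)"
    and cont: "\<And>w. isCont (\<lambda>z. F z w) y"
    and V: "(V has_derivative V') (at y)"
  shows "((\<lambda>z. F z (V z)) has_derivative (\<lambda>u. F' u + F y (V' u))) (at y)"
proof -
  have liny: "linear (F y)" using lin by (simp add: eventually_nhds_conv_at)
  have i: "((\<lambda>z. ((V z - V y) \<bullet> i) * F z i) has_derivative (\<lambda>u. (V' u \<bullet> i) * F y i)) (at y)" for i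
  proof (rule has_derivative_mult_zero)
    have "((\<lambda>z. V z - V y) has_derivative V') (at y)"
      using has_derivative_diff[OF V has_derivative_const] by fastforce
    then show "((\<lambda>z. (V z - V y) \<bullet> i) has_derivative (\<lambda>u. V' u \<bullet> i)) (at y)"
      by (rule has_derivative_inner_left)
  qed (auto intro: cont)
  have "((\<lambda>z. F z (V y) + (\<Sum>i\<in>Basis. ((V z - V y) \<bullet> i) * F z i)) has_derivative
      (\<lambda>u. F' u + (\<Sum>i\<in>Basis. (V' u \<bullet> i) * F y i))) (at y)"
    by (intro has_derivative_add has_derivative_sum F' i)
  moreover have expand: "(\<Sum>i\<in>Basis. (w \<bullet> i) * F z i) = F z w" if "linear (F z)" for z w
    by (subst (2) euclidean_representation[of w, symmetric], subst linear_sum[OF that])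
      (simp add: linear_scale[OF that])
  ultimately have "((\<lambda>z. F z (V y) + (\<Sum>i\<in>Basis. ((V z - V y) \<bullet> i) * F z i)) has_derivative
      (\<lambda>u. F' u + F y (V' u))) (at y)" using liny by simp
  then show ?thesis
  proof (rule has_derivative_transform_eventually)
    have *: "\<forall>\<^sub>F z in nhds y. F z (V y) + (\<Sum>i\<in>Basis. ((V z - V y) \<bullet> i) * F z i) = F z (V z)"
      using lin
    proof eventually_elim
      case (elim z)
      with expand[of z "V z - V y"] show ?case
        by (simp add: linear_diff[OF elim])
    qed
    then show "\<forall>\<^sub>F z in at y. F z (V y) + (\<Sum>i\<in>Basis. ((V z - V y) \<bullet> i) * F z i) = F z (V z)"
      "F y (V y) + (\<Sum>i\<in>Basis. ((V y - V y) \<bullet> i) * F y i) = F y (V y)"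
      by (auto simp: eventually_nhds_conv_at)
  qed simp
qed


section \<open>Charts and changes of components\<close>

locale smooth_manifold =
  fixes A :: "('m::{t2_space,second_countable_topology}, 'e::euclidean_space) chart set"
  assumes smooth_atlas: "smooth_atlas A"
begin

lemma is_chart: "c \<in> A \<Longrightarrow> is_chart c"
  using smooth_atlas by (simp add: smooth_atlas_def)

lemma open_chart_domain: "c \<in> A \<Longrightarrow> open (fst c)"
  and open_chart_image: "c \<in> A \<Longrightarrow> open (snd c ` fst c)"
  using is_chart by (auto simp: is_chart_def)

lemma chart_inv_chart: "c \<in> A \<Longrightarrow> x \<in> fst c \<Longrightarrow> chart_inv c (snd c x) = x"
  using is_chart by (auto simp: is_chart_def homeomorphism_def)

lemma chart_chart_inv: "c \<in> A \<Longrightarrow> y \<in> snd c ` fst c \<Longrightarrow> snd c (chart_inv c y) = y"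
  by (elim imageE) (simp add: chart_inv_chart)

lemma chart_inv_in_domain: "c \<in> A \<Longrightarrow> y \<in> snd c ` fst c \<Longrightarrow> chart_inv c y \<in> fst c"
  by (elim imageE) (simp add: chart_inv_chart)

lemma continuous_on_chart: "c \<in> A \<Longrightarrow> continuous_on (fst c) (snd c)"
  and continuous_on_chart_inv: "c \<in> A \<Longrightarrow> continuous_on (snd c ` fst c) (chart_inv c)"
  using is_chart by (auto simp: is_chart_def homeomorphism_def)

lemma open_overlap:
  assumes "c \<in> A" "d \<in> A"
  shows "open (snd c ` (fst c \<inter> fst d))"
proof -
  have "snd c ` (fst c \<inter> fst d) = snd c ` fst c \<inter> chart_inv c -` fst d"
    using chart_inv_chart[OF assms(1)] by force
  then show ?thesis
    using continuous_open_preimage[OF continuous_on_chart_inv open_chart_image open_chart_domain] assms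
    by metis
qed

lemma chart_at: "chart_at A x \<in> A" "x \<in> fst (chart_at A x)"
proof -
  have "\<exists>c. c \<in> A \<and> x \<in> fst c" using smooth_atlas unfolding smooth_atlas_def by blast
  from someI_ex[OF this] show "chart_at A x \<in> A" "x \<in> fst (chart_at A x)"
    by (auto simp: chart_at_def)
qed

lemma transition_differentiable:
  assumes "c \<in> A" "d \<in> A" "x \<in> fst c" "x \<in> fst d"
  shows "(snd d \<circ> chart_inv c) differentiable (at (snd c x))"
proof -
  have "Ck_on (Suc 0) (snd d \<circ> chart_inv c) (snd c ` (fst c \<inter> fst d))"
    using smooth_atlas assms(1,2) unfolding smooth_atlas_def smooth_on_def by blast
  then show ?thesis using assms(3,4) by auto
qed

text \<open>The chain rule through the transition map. The composite agrees with
  \<open>p \<circ> chart_inv c\<close> on the overlap of the charts, whose image is open, and this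
  determines the derivative.\<close>

lemma has_derivative_chart_change:
  assumes "c \<in> A" "d \<in> A" "x \<in> fst c" "x \<in> fst d"
    and P: "((p \<circ> chart_inv d) has_derivative P) (at (snd d x))"
  shows "((p \<circ> chart_inv c) has_derivative
    (\<lambda>u. P (frechet_derivative (snd d \<circ> chart_inv c) (at (snd c x)) u))) (at (snd c x))"
proof -
  have "((snd d \<circ> chart_inv c) has_derivative frechet_derivative (snd d \<circ> chart_inv c) (at (snd c x)))
      (at (snd c x))"
    using transition_differentiable[OF assms(1-4)] by (simp add: frechet_derivative_works)
  moreover have "(snd d \<circ> chart_inv c) (snd c x) = snd d x"
    using assms by (simp add: chart_inv_chart)
  ultimately have "(((p \<circ> chart_inv d) \<circ> (snd d \<circ> chart_inv c)) has_derivative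
      (P \<circ> frechet_derivative (snd d \<circ> chart_inv c) (at (snd c x)))) (at (snd c x))"
    using P by (intro diff_chain_at) simp_all
  then have "(((p \<circ> chart_inv d) \<circ> (snd d \<circ> chart_inv c)) has_derivative
    (\<lambda>u. P (frechet_derivative (snd d \<circ> chart_inv c) (at (snd c x)) u))) (at (snd c x))"
    by (simp add: o_def)
  then show ?thesis
  proof (rule has_derivative_transform_within_open)
    show "open (snd c ` (fst c \<inter> fst d))" "snd c x \<in> snd c ` (fst c \<inter> fst d)"
      using assms open_overlap by auto
    show "(p \<circ> chart_inv d \<circ> (snd d \<circ> chart_inv c)) z = (p \<circ> chart_inv c) z"
      if "z \<in> snd c ` (fst c \<inter> fst d)" for z
      using that assms by (elim imageE IntE) (simp add: chart_inv_chart)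
  qed
qed

lemma has_derivative_chart_self:
  assumes "c \<in> A" "x \<in> fst c"
  shows "((snd c \<circ> chart_inv c) has_derivative (\<lambda>u. u)) (at (snd c x))"
  by (rule has_derivative_transform_within_open[OF has_derivative_ident open_chart_image[OF assms(1)]])
    (use assms in \<open>auto simp: chart_chart_inv chart_inv_chart\<close>)

lemma linear_to_chart: "c \<in> A \<Longrightarrow> x \<in> fst c \<Longrightarrow> linear (to_chart A c x)"
  unfolding to_chart_def
  by (intro linear_frechet_derivative transition_differentiable chart_at)

lemma linear_from_chart: "c \<in> A \<Longrightarrow> x \<in> fst c \<Longrightarrow> linear (from_chart A c x)"
  unfolding from_chart_def
  by (intro linear_frechet_derivative transition_differentiable chart_at)

text \<open>The chart change is applied to \<open>p = snd c\<close>, whose representation in its own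
  chart is the identity, so the two Jacobians compose to the identity. The other composition
  exchanges the roles of the charts.\<close>

lemma to_chart_from_chart:
  assumes "c \<in> A" "x \<in> fst c"
  shows "to_chart A c x (from_chart A c x u) = u"
proof -
  let ?d = "chart_at A x"
  have "((snd c \<circ> chart_inv ?d) has_derivative to_chart A c x) (at (snd ?d x))"
    unfolding to_chart_def frechet_derivative_works[symmetric]
    by (intro transition_differentiable chart_at assms)
  from has_derivative_chart_change[OF assms(1) chart_at(1) assms(2) chart_at(2) this]
  have "(\<lambda>u. to_chart A c x (from_chart A c x u)) = (\<lambda>u. u)"
    using has_derivative_unique[OF _ has_derivative_chart_self[OF assms]] by (auto simp: from_chart_def)
  then show ?thesis by meson
qed

lemma from_chart_to_chart:
  assumes "c \<in> A" "x \<in> fst c"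
  shows "from_chart A c x (to_chart A c x u) = u"
proof -
  let ?d = "chart_at A x"
  have "((snd ?d \<circ> chart_inv c) has_derivative from_chart A c x) (at (snd c x))"
    unfolding from_chart_def frechet_derivative_works[symmetric]
    by (intro transition_differentiable chart_at assms)
  from has_derivative_chart_change[OF chart_at(1) assms(1) chart_at(2) assms(2) this]
  have "(\<lambda>u. from_chart A c x (to_chart A c x u)) = (\<lambda>u. u)"
    using has_derivative_unique[OF _ has_derivative_chart_self[OF chart_at]] by (auto simp: to_chart_def)
  then show ?thesis by meson
qed

lemma from_chart_at: "from_chart A (chart_at A x) x = (\<lambda>u. u)"
  unfolding from_chart_def
  by (rule frechet_derivative_at[symmetric, OF has_derivative_chart_self[OF chart_at]])

lemma to_chart_at: "to_chart A (chart_at A x) x = (\<lambda>u. u)"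
  unfolding to_chart_def
  by (rule frechet_derivative_at[symmetric, OF has_derivative_chart_self[OF chart_at]])

end


section \<open>Gradient and Hessian in charts\<close>

locale riemannian_C2_function =
  fixes A :: "('m::{t2_space,second_countable_topology}, 'e::euclidean_space) chart set"
    and g :: "'m \<Rightarrow> 'e \<Rightarrow> 'e \<Rightarrow> real"
    and f :: "'m \<Rightarrow> real"
  assumes riemannian_manifold: "riemannian_manifold A g" and C2_function: "C2_function A f"
begin

sublocale smooth_manifold A
  using riemannian_manifold by unfold_locales (simp add: riemannian_manifold_def)

lemma metric_spd: "spd_form (g x)"
  using riemannian_manifold
  by (simp add: riemannian_manifold_def riemannian_metric_def spd_form_def)

abbreviation "gram c y \<equiv> metric_in_chart A g c y"

abbreviation "dmetric c y v w u \<equiv> frechet_derivative (\<lambda>z. gram c z v w) (at y) u"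

abbreviation "df c y w \<equiv> frechet_derivative (f \<circ> chart_inv c) (at y) w"

abbreviation "d2f c y w u \<equiv> frechet_derivative (\<lambda>z. df c z w) (at y) u"

abbreviation "grad_sq x \<equiv> g x (rgrad A g f x) (rgrad A g f x)"

text \<open>The components of the gradient in one fixed chart. Those of \<open>rgrad\<close> refer
  to the preferred chart of each point and may jump with it, whereas this field turns out to be
  differentiable.\<close>

definition chart_grad :: "('m, 'e) chart \<Rightarrow> 'e \<Rightarrow> 'e" where
  "chart_grad c y = to_chart A c (chart_inv c y) (rgrad A g f (chart_inv c y))"

section \<open>The metric, and the first two derivatives of \<open>f\<close>, in a chart\<close>

lemma metric_in_chart_spd:
  assumes c: "c \<in> A" and y: "y \<in> snd c ` fst c"
  shows "spd_form (gram c y)"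
proof -
  let ?x = "chart_inv c y"
  have x: "?x \<in> fst c" using chart_inv_in_domain[OF c y] .
  have bl: "bilinear (g ?x)" and sym: "\<And>u v. g ?x u v = g ?x v u"
    and pos: "\<And>v. v \<noteq> 0 \<Longrightarrow> 0 < g ?x v v"
    using metric_spd by (auto simp: spd_form_def)
  have l: "linear (from_chart A c ?x)" by (rule linear_from_chart[OF c x])
  have "from_chart A c ?x v \<noteq> 0" if "v \<noteq> 0" for v
    using to_chart_from_chart[OF c x, of v] that linear_0[OF linear_to_chart[OF c x]] by auto
  moreover have "bilinear (gram c y)"
    unfolding bilinear_def metric_in_chart_def
    by (intro conjI allI linearI)
      (simp_all add: linear_add[OF l] linear_scale[OF l] bilinear_ladd[OF bl] bilinear_radd[OF bl]
        bilinear_lmul[OF bl] bilinear_rmul[OF bl])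
  ultimately show ?thesis using sym pos by (simp add: spd_form_def metric_in_chart_def)
qed

lemma Ck_metric: "c \<in> A \<Longrightarrow> Ck_on k (\<lambda>y. gram c y u v) (snd c ` fst c)"
  using riemannian_manifold
  by (simp add: riemannian_manifold_def riemannian_metric_def smooth_on_def)

lemma metric_differentiable:
  "c \<in> A \<Longrightarrow> y \<in> snd c ` fst c \<Longrightarrow> (\<lambda>z. gram c z u v) differentiable (at y)"
  using Ck_metric[of c "Suc 0" u v] by auto

lemma continuous_on_dmetric: "c \<in> A \<Longrightarrow> continuous_on (snd c ` fst c) (\<lambda>y. dmetric c y v w u)"
  using Ck_metric[of c "Suc 0" v w] by auto

lemma Ck_function: "c \<in> A \<Longrightarrow> Ck_on (Suc (Suc 0)) (f \<circ> chart_inv c) (snd c ` fst c)"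
  using C2_function by (simp add: C2_function_def numeral_2_eq_2)

lemma function_differentiable:
  "c \<in> A \<Longrightarrow> y \<in> snd c ` fst c \<Longrightarrow> (f \<circ> chart_inv c) differentiable (at y)"
  using Ck_function[of c] by auto

lemma df_differentiable:
  "c \<in> A \<Longrightarrow> y \<in> snd c ` fst c \<Longrightarrow> (\<lambda>z. df c z w) differentiable (at y)"
  using Ck_function[of c] by auto

lemma continuous_on_d2f: "c \<in> A \<Longrightarrow> continuous_on (snd c ` fst c) (\<lambda>y. d2f c y w u)"
  using Ck_function[of c] by auto

lemma linear_df: "c \<in> A \<Longrightarrow> y \<in> snd c ` fst c \<Longrightarrow> linear (df c y)"
  by (intro linear_frechet_derivative function_differentiable)

lemma eventually_chart_image: "c \<in> A \<Longrightarrow> y \<in> snd c ` fst c \<Longrightarrow> \<forall>\<^sub>F z in nhds y. z \<in> snd c ` fst c"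
  using open_chart_image by (simp add: eventually_nhds_in_open)

lemma eventually_bilinear_metric:
  assumes "c \<in> A" "y \<in> snd c ` fst c"
  shows "\<forall>\<^sub>F z in nhds y. bilinear (gram c z)"
  using eventually_chart_image[OF assms]
  by eventually_elim (use metric_in_chart_spd[OF assms(1)] in \<open>auto simp: spd_form_def\<close>)

lemma bilinear_dmetric:
  assumes c: "c \<in> A" and y: "y \<in> snd c ` fst c"
  shows "bilinear (\<lambda>v w. dmetric c y v w u)"
proof -
  have bl: "\<And>z. z \<in> snd c ` fst c \<Longrightarrow> bilinear (gram c z)"
    using metric_in_chart_spd[OF c] by (simp add: spd_form_def)
  \<comment> \<open>Bilinearity of \<open>gram c z\<close> is known for \<open>z\<close> in the open
    chart image; being local, the derivative at \<open>y\<close> inherits it.\<close>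
  have eq: "frechet_derivative h (at y) u = D u"
    if "(h' has_derivative D) (at y)" "\<And>z. z \<in> snd c ` fst c \<Longrightarrow> h' z = h z" for h h' D
    using frechet_derivative_at[OF has_derivative_transform_within_open[OF that(1) open_chart_image[OF c] y that(2)]]
    by simp
  have d: "((\<lambda>z. gram c z v w) has_derivative dmetric c y v w) (at y)" for v w
    using metric_differentiable[OF c y] by (simp add: frechet_derivative_works)
  show ?thesis
    unfolding bilinear_def
  proof (intro conjI allI linearI)
    fix v v' w r
    show "dmetric c y v (w + v') u = dmetric c y v w u + dmetric c y v v' u"
      by (rule eq[OF has_derivative_add[OF d d]]) (simp add: bilinear_radd[OF bl])
    show "dmetric c y v (r *\<^sub>R w) u = r *\<^sub>R dmetric c y v w u"
      by (rule eq[OF has_derivative_scaleR_right[OF d]]) (simp add: bilinear_rmul[OF bl])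
    show "dmetric c y (v + v') w u = dmetric c y v w u + dmetric c y v' w u"
      by (rule eq[OF has_derivative_add[OF d d]]) (simp add: bilinear_ladd[OF bl])
    show "dmetric c y (r *\<^sub>R v) w u = r *\<^sub>R dmetric c y v w u"
      by (rule eq[OF has_derivative_scaleR_right[OF d]]) (simp add: bilinear_lmul[OF bl])
  qed
qed

lemma linear_dmetric:
  "c \<in> A \<Longrightarrow> y \<in> snd c ` fst c \<Longrightarrow> linear (dmetric c y v w)"
  by (intro linear_frechet_derivative metric_differentiable)

lemma bilinear_d2f:
  assumes c: "c \<in> A" and y: "y \<in> snd c ` fst c"
  shows "bilinear (d2f c y)"
proof -
  have lin: "\<And>z. z \<in> snd c ` fst c \<Longrightarrow> linear (df c z)" by (rule linear_df[OF c])
  have eq: "frechet_derivative h (at y) u = D u"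
    if "(h' has_derivative D) (at y)" "\<And>z. z \<in> snd c ` fst c \<Longrightarrow> h' z = h z" for h h' D u
    using frechet_derivative_at[OF has_derivative_transform_within_open[OF that(1) open_chart_image[OF c] y that(2)]]
    by simp
  have d: "((\<lambda>z. df c z w) has_derivative d2f c y w) (at y)" for w
    using df_differentiable[OF c y] by (simp add: frechet_derivative_works)
  show ?thesis
    unfolding bilinear_def
  proof (intro conjI allI linear_frechet_derivative df_differentiable c y)
    fix u
    show "linear (\<lambda>w. d2f c y w u)"
    proof (rule linearI)
      fix v w r
      show "d2f c y (v + w) u = d2f c y v u + d2f c y w u"
        by (rule eq[OF has_derivative_add[OF d d]]) (simp add: linear_add[OF lin])
      show "d2f c y (r *\<^sub>R w) u = r *\<^sub>R d2f c y w u"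
        by (rule eq[OF has_derivative_scaleR_right[OF d]]) (simp add: linear_scale[OF lin])
    qed
  qed
qed

lemma christoffel:
  assumes "c \<in> A" "y \<in> snd c ` fst c"
  shows "bilinear (christoffel A g c y)"
    and "dmetric c y v w u
      = gram c y (christoffel A g c y u v) w + gram c y v (christoffel A g c y u w)"
proof -
  have "gram c z v w = gram c z w v" if "z \<in> snd c ` fst c" for z v w
    using metric_in_chart_spd[OF assms(1) that] by (simp add: spd_form_def)
  then have "dmetric c y v w u = dmetric c y w v u" for u v w
    using frechet_derivative_at[OF has_derivative_transform_within_open[OF
          metric_differentiable[OF assms, of w v, unfolded frechet_derivative_works]
          open_chart_image[OF assms(1)] assms(2), of "\<lambda>z. gram c z v w"]]
    by metis
  from theI'[OF Koszul_unique[OF metric_in_chart_spd[OF assms] linear_dmetric[OF assms]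
        bilinear_dmetric[OF assms] this]]
  show "bilinear (christoffel A g c y)" "dmetric c y v w u
      = gram c y (christoffel A g c y u v) w + gram c y v (christoffel A g c y u w)"
    unfolding christoffel_def by blast+
qed

section \<open>The gradient and its squared length\<close>

lemma linear_differential: "linear (differential A f x)"
  unfolding differential_def
  by (intro linear_frechet_derivative function_differentiable) (auto intro: chart_at)

lemma rgrad: "g x (rgrad A g f x) w = differential A f x w"
  using theI'[OF spd_form_Riesz[OF metric_spd linear_differential]] unfolding rgrad_def by blast

lemma differential_from_chart:
  assumes "c \<in> A" "x \<in> fst c"
  shows "differential A f x (from_chart A c x u) = df c (snd c x) u"
proof -
  have "((f \<circ> chart_inv (chart_at A x)) has_derivative differential A f x) (at (snd (chart_at A x) x))"
    unfolding differential_def frechet_derivative_works[symmetric]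
    by (intro function_differentiable) (auto intro: chart_at)
  from frechet_derivative_at[OF has_derivative_chart_change[OF assms(1) chart_at(1) assms(2) chart_at(2) this]]
  show ?thesis by (metis from_chart_def)
qed

lemma from_chart_chart_grad:
  assumes "c \<in> A" "y \<in> snd c ` fst c"
  shows "from_chart A c (chart_inv c y) (chart_grad c y) = rgrad A g f (chart_inv c y)"
  unfolding chart_grad_def by (intro from_chart_to_chart chart_inv_in_domain assms)

lemma metric_chart_grad:
  assumes "c \<in> A" "y \<in> snd c ` fst c"
  shows "gram c y (chart_grad c y) w = df c y w"
  using differential_from_chart[OF assms(1) chart_inv_in_domain[OF assms]]
  by (simp add: metric_in_chart_def from_chart_chart_grad[OF assms] rgrad chart_chart_inv[OF assms])

text \<open>\<open>rhess\<close> applies \<open>frechet_derivative\<close> to this field, which is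
  meaningful only once differentiability is known. The field is dual to \<open>df\<close>, and both
  \<open>df\<close> and the Gram form are differentiable in the chart.\<close>

lemma chart_grad_differentiable:
  assumes "c \<in> A" "y \<in> snd c ` fst c"
  shows "chart_grad c differentiable (at y)"
proof (rule dual_vector_differentiable[where m = "metric_in_chart A g c" and F = "df c"])
  show "spd_form (gram c y)" by (rule metric_in_chart_spd[OF assms])
  show "\<forall>\<^sub>F z in nhds y. linear (df c z)"
    using eventually_chart_image[OF assms] by eventually_elim (rule linear_df[OF assms(1)])
  show "\<forall>\<^sub>F z in nhds y. \<forall>w. gram c z (chart_grad c z) w = df c z w"
    using eventually_chart_image[OF assms] by eventually_elim (simp add: metric_chart_grad[OF assms(1)])
qed (intro metric_differentiable df_differentiable eventually_bilinear_metric assms)+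

lemma grad_sq_in_chart:
  assumes "c \<in> A" "y \<in> snd c ` fst c"
  shows "grad_sq (chart_inv c y) = gram c y (chart_grad c y) (chart_grad c y)"
  by (simp add: metric_in_chart_def from_chart_chart_grad[OF assms])

text \<open>The product rule, one slot at a time: \<open>inner\<close> lets the field vary in the
  first slot with \<open>w\<close> fixed, and its derivative feeds the treatment of the second
  slot.\<close>

lemma grad_sq_derivative_metric:
  assumes c: "c \<in> A" and y: "y \<in> snd c ` fst c"
    and V: "(chart_grad c has_derivative V') (at y)"
  shows "((\<lambda>z. grad_sq (chart_inv c z)) has_derivative
    (\<lambda>u. dmetric c y (chart_grad c y) (chart_grad c y) u + 2 * gram c y (chart_grad c y) (V' u))) (at y)"
proof -
  let ?V = "chart_grad c" and ?v = "chart_grad c y"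
  have spd: "spd_form (gram c z)" if "z \<in> snd c ` fst c" for z
    using metric_in_chart_spd[OF c that] .
  have cont: "isCont (\<lambda>z. gram c z u v) y" for u v
    using metric_differentiable[OF c y] by (rule differentiable_imp_continuous_within)
  have inner: "((\<lambda>z. gram c z (?V z) w) has_derivative (\<lambda>u. dmetric c y ?v w u + gram c y (V' u) w)) (at y)" for w
  proof (rule linear_family_derivative[OF _ _ cont V])
    show "\<forall>\<^sub>F z in nhds y. linear (\<lambda>v. gram c z v w)"
      using eventually_bilinear_metric[OF c y] by eventually_elim (simp add: bilinear_def)
  qed (use metric_differentiable[OF c y] in \<open>simp add: frechet_derivative_works[symmetric]\<close>)
  have "((\<lambda>z. gram c z (?V z) (?V z)) has_derivative
      (\<lambda>u. (dmetric c y ?v ?v u + gram c y (V' u) ?v) + gram c y ?v (V' u))) (at y)"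
  proof (rule linear_family_derivative[OF _ inner _ V])
    show "\<forall>\<^sub>F z in nhds y. linear (gram c z (?V z))"
      using eventually_bilinear_metric[OF c y] by eventually_elim (simp add: bilinear_def)
    show "isCont (\<lambda>z. gram c z (?V z) w) y" for w
      using inner by (rule has_derivative_continuous)
  qed
  moreover have "gram c y (V' u) ?v = gram c y ?v (V' u)" for u
    using spd[OF y] by (simp add: spd_form_def)
  ultimately have "((\<lambda>z. gram c z (?V z) (?V z)) has_derivative
      (\<lambda>u. dmetric c y ?v ?v u + 2 * gram c y ?v (V' u))) (at y)"
    by (simp add: algebra_simps)
  then show ?thesis
    by (rule has_derivative_transform_within_open[OF _ open_chart_image[OF c] y])
      (simp add: grad_sq_in_chart[OF c])
qed

text \<open>The same function written as \<open>df\<close> applied to the gradient. Now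
  \<open>V'\<close> occurs once, against twice in the metric form, which is what makes its
  elimination possible.\<close>

lemma grad_sq_derivative_df:
  assumes c: "c \<in> A" and y: "y \<in> snd c ` fst c"
    and V: "(chart_grad c has_derivative V') (at y)"
  shows "((\<lambda>z. grad_sq (chart_inv c z)) has_derivative
    (\<lambda>u. d2f c y (chart_grad c y) u + gram c y (chart_grad c y) (V' u))) (at y)"
proof -
  let ?V = "chart_grad c" and ?v = "chart_grad c y"
  have "((\<lambda>z. df c z (?V z)) has_derivative (\<lambda>u. d2f c y ?v u + df c y (V' u))) (at y)"
  proof (rule linear_family_derivative[OF _ _ _ V])
    show "\<forall>\<^sub>F z in nhds y. linear (df c z)"
      using eventually_chart_image[OF c y] by eventually_elim (rule linear_df[OF c])
    show "isCont (\<lambda>z. df c z w) y" for w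
      using df_differentiable[OF c y] by (rule differentiable_imp_continuous_within)
  qed (rule iffD1[OF frechet_derivative_works df_differentiable[OF c y]])
  then have "((\<lambda>z. df c z (?V z)) has_derivative
      (\<lambda>u. d2f c y ?v u + gram c y ?v (V' u))) (at y)"
    by (simp add: metric_chart_grad[OF c y])
  then show ?thesis
    by (rule has_derivative_transform_within_open[OF _ open_chart_image[OF c] y])
      (simp add: grad_sq_in_chart[OF c] metric_chart_grad[OF c])
qed

text \<open>Eliminating the derivative of the gradient between the two expressions for the derivative of
  \<open>grad_sq\<close> leaves only second derivatives of \<open>f\<close> and first derivatives of the metric.\<close>

lemma grad_sq_derivative:
  assumes c: "c \<in> A" and y: "y \<in> snd c ` fst c"
  shows "((\<lambda>z. grad_sq (chart_inv c z)) has_derivative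
    (\<lambda>u. 2 * d2f c y (chart_grad c y) u - dmetric c y (chart_grad c y) (chart_grad c y) u)) (at y)"
proof -
  obtain V' where V: "(chart_grad c has_derivative V') (at y)"
    using chart_grad_differentiable[OF c y] by (auto simp: differentiable_def)
  note 1 = grad_sq_derivative_metric[OF c y V] and 2 = grad_sq_derivative_df[OF c y V]
  have "(\<lambda>u. dmetric c y (chart_grad c y) (chart_grad c y) u + 2 * gram c y (chart_grad c y) (V' u))
      = (\<lambda>u. d2f c y (chart_grad c y) u + gram c y (chart_grad c y) (V' u))"
    by (rule has_derivative_unique[OF 1 2])
  then have "dmetric c y (chart_grad c y) (chart_grad c y) u + 2 * gram c y (chart_grad c y) (V' u)
      = d2f c y (chart_grad c y) u + gram c y (chart_grad c y) (V' u)" for u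
    by meson
  then have "d2f c y (chart_grad c y) u + gram c y (chart_grad c y) (V' u)
      = 2 * d2f c y (chart_grad c y) u - dmetric c y (chart_grad c y) (chart_grad c y) u" for u
    by (smt (verit))
  with 2 show ?thesis by simp
qed

section \<open>The Hessian as derivative of the squared gradient norm\<close>

lemma rhess_eq:
  fixes x
  defines "c \<equiv> chart_at A x"
  shows "rhess A g f x s = frechet_derivative (chart_grad c) (at (snd c x)) s
    + christoffel A g c (snd c x) s (rgrad A g f x)"
  unfolding rhess_def cov_deriv_def Let_def c_def chart_grad_def[abs_def] by simp

lemma linear_rhess: "linear (rhess A g f x)"
proof -
  let ?c = "chart_at A x"
  have y: "snd ?c x \<in> snd ?c ` fst ?c" using chart_at by auto
  have "linear (\<lambda>s. christoffel A g ?c (snd ?c x) s (rgrad A g f x))"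
    using christoffel(1)[OF chart_at(1) y] by (simp add: bilinear_def)
  then have "linear (\<lambda>s. frechet_derivative (chart_grad ?c) (at (snd ?c x)) s
      + christoffel A g ?c (snd ?c x) s (rgrad A g f x))"
    by (intro linear_compose_add linear_frechet_derivative chart_grad_differentiable chart_at y)
  then show ?thesis by (simp only: rhess_eq[abs_def])
qed

text \<open>Metric compatibility: in the preferred chart at \<open>x\<close> the derivative of the
  metric equals twice the inner product of the gradient with the Christoffel term, which completes
  \<open>V'\<close> to the covariant derivative. A chart change transports the formula to
  \<open>c\<close>.\<close>

lemma grad_sq_derivative_rhess:
  assumes "c \<in> A" "x \<in> fst c"
  shows "((\<lambda>z. grad_sq (chart_inv c z)) has_derivative
    (\<lambda>u. 2 * g x (rgrad A g f x) (rhess A g f x (from_chart A c x u)))) (at (snd c x))"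
proof -
  let ?d = "chart_at A x"
  let ?y = "snd ?d x" and ?G = "rgrad A g f x"
  have y: "?y \<in> snd ?d ` fst ?d" using chart_at by auto
  have V: "(chart_grad ?d has_derivative frechet_derivative (chart_grad ?d) (at ?y)) (at ?y)"
    using chart_grad_differentiable[OF chart_at(1) y] by (simp add: frechet_derivative_works)
  have inv: "chart_inv ?d ?y = x" using chart_inv_chart chart_at by blast
  have grad: "chart_grad ?d ?y = ?G" by (simp add: chart_grad_def inv to_chart_at)
  have metric: "gram ?d ?y = g x"
    by (intro ext) (simp add: metric_in_chart_def inv from_chart_at)
  have bl: "bilinear (g x)" and sym: "g x u v = g x v u" for u v
    using metric_spd by (auto simp: spd_form_def)
  have "((\<lambda>z. grad_sq (chart_inv ?d z)) has_derivative
    (\<lambda>u. 2 * g x ?G (rhess A g f x u))) (at ?y)"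
    using grad_sq_derivative_metric[OF chart_at(1) y V]
    by (simp add: grad metric christoffel(2)[OF chart_at(1) y] rhess_eq bilinear_radd[OF bl]
        sym[of "christoffel _ _ _ _ _ _"] algebra_simps)
  then have "((grad_sq \<circ> chart_inv ?d) has_derivative (\<lambda>u. 2 * g x ?G (rhess A g f x u))) (at ?y)"
    by (simp add: o_def)
  from has_derivative_chart_change[OF assms(1) chart_at(1) assms(2) chart_at(2) this]
  show ?thesis by (simp add: o_def from_chart_def)
qed

lemma rhess_grad_in_chart:
  assumes c: "c \<in> A" and x: "x \<in> fst c"
  defines "V \<equiv> chart_grad c (snd c x)"
  shows "2 * g x (rgrad A g f x) (rhess A g f x (from_chart A c x u))
    = 2 * d2f c (snd c x) V u - dmetric c (snd c x) V V u"
proof -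
  have y: "snd c x \<in> snd c ` fst c" using x by auto
  show ?thesis
    using fun_cong[OF has_derivative_unique[OF grad_sq_derivative[OF c y] grad_sq_derivative_rhess[OF c x]], of u]
    unfolding V_def by simp
qed

end


section \<open>Estimates near a point\<close>

context smooth_manifold
begin

lemma tendsto_chart:
  assumes "c \<in> A" "x0 \<in> fst c"
  shows "(snd c \<longlongrightarrow> snd c x0) (nhds x0)"
proof -
  have "isCont (snd c) x0"
    using continuous_on_chart[OF assms(1)] open_chart_domain[OF assms(1)] assms(2)
    by (simp add: continuous_on_eq_continuous_at)
  then show ?thesis by (simp add: isCont_def tendsto_nhds_iff)
qed

lemma eventually_nhds_chart:
  assumes "c \<in> A" "x0 \<in> fst c" "\<forall>\<^sub>F y in nhds (snd c x0). P y"
  shows "\<forall>\<^sub>F x in nhds x0. x \<in> fst c \<and> P (snd c x)"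
  using eventually_compose_filterlim[OF assms(3) tendsto_chart[OF assms(1,2)]]
    eventually_nhds_in_open[OF open_chart_domain[OF assms(1)] assms(2)]
  by eventually_elim simp

lemma tendsto_chart_inv:
  assumes "c \<in> A" "x0 \<in> fst c"
  shows "(chart_inv c \<longlongrightarrow> x0) (nhds (snd c x0))"
proof -
  have "isCont (chart_inv c) (snd c x0)"
    using continuous_on_chart_inv[OF assms(1)] open_chart_image[OF assms(1)] assms(2)
    by (simp add: continuous_on_eq_continuous_at)
  then show ?thesis by (simp add: isCont_def tendsto_nhds_iff chart_inv_chart[OF assms])
qed

text \<open>The ball is closed so that the limit of the coordinates of the iterates cannot leave it;
  it lies in the chart image so that this limit is the coordinate of a point.\<close>

lemma eventually_chart_cball:
  assumes c: "c \<in> A" and x0: "x0 \<in> fst c" and P: "\<forall>\<^sub>F x in nhds x0. P x"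
  obtains r where "r > 0" "cball (snd c x0) r \<subseteq> snd c ` fst c"
    "\<And>x. x \<in> fst c \<Longrightarrow> norm (snd c x - snd c x0) \<le> r \<Longrightarrow> P x"
proof -
  have "\<forall>\<^sub>F y in nhds (snd c x0). P (chart_inv c y)"
    using eventually_compose_filterlim[OF P tendsto_chart_inv[OF c x0]] .
  moreover have "\<forall>\<^sub>F y in nhds (snd c x0). y \<in> snd c ` fst c"
    using open_chart_image[OF c] x0 by (simp add: eventually_nhds_in_open)
  ultimately have "\<forall>\<^sub>F y in nhds (snd c x0). P (chart_inv c y) \<and> y \<in> snd c ` fst c"
    by (rule eventually_conj)
  then obtain e where e: "e > 0" "\<And>y. dist y (snd c x0) < e \<Longrightarrow> P (chart_inv c y) \<and> y \<in> snd c ` fst c"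
    by (auto simp: eventually_nhds_metric)
  show ?thesis
  proof
    show "e / 2 > 0" using e(1) by simp
    show "cball (snd c x0) (e / 2) \<subseteq> snd c ` fst c"
    proof
      fix y assume "y \<in> cball (snd c x0) (e / 2)"
      then have "dist y (snd c x0) < e" using e(1) by (simp add: dist_commute)
      then show "y \<in> snd c ` fst c" using e(2) by blast
    qed
    fix x assume x: "x \<in> fst c" "norm (snd c x - snd c x0) \<le> e / 2"
    then have "dist (snd c x) (snd c x0) < e" using e(1) by (simp add: dist_norm)
    then show "P x" using e(2) chart_inv_chart[OF c x(1)] by metis
  qed
qed

end

text \<open>Coercivity of the Gram forms near the base point, after taking square roots. It converts
  bounds on Riemannian norms into bounds on chart components, with one constant for all nearby
  points.\<close>

lemma (in riemannian_C2_function) tnorm_ge_chart: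
  assumes c: "c \<in> A" and x0: "x0 \<in> fst c"
  obtains \<kappa> where "\<kappa> > 0"
    "\<forall>\<^sub>F x in nhds x0. x \<in> fst c \<and> (\<forall>s. \<kappa> * norm (to_chart A c x s) \<le> tnorm g x s)"
proof -
  have y0: "snd c x0 \<in> snd c ` fst c" using x0 by simp
  have "isCont (\<lambda>z. gram c z u v) (snd c x0)" for u v
    using metric_differentiable[OF c y0] by (rule differentiable_imp_continuous_within)
  then have "((\<lambda>z. gram c z u v) \<longlongrightarrow> gram c (snd c x0) u v) (nhds (snd c x0))" for u v
    by (simp add: isCont_def tendsto_nhds_iff)
  from spd_family_bounds[of "metric_in_chart A g c", OF metric_in_chart_spd[OF c y0]
      eventually_bilinear_metric[OF c y0] this]
  obtain \<kappa> where \<kappa>: "\<kappa> > 0" "\<forall>\<^sub>F z in nhds (snd c x0). \<forall>u. \<kappa> * (norm u)\<^sup>2 \<le> gram c z u u"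
    by blast
  show ?thesis
  proof
    show "sqrt \<kappa> > 0" using \<kappa>(1) by simp
    show "\<forall>\<^sub>F x in nhds x0. x \<in> fst c \<and> (\<forall>s. sqrt \<kappa> * norm (to_chart A c x s) \<le> tnorm g x s)"
      using eventually_nhds_chart[OF c x0 \<kappa>(2)]
    proof eventually_elim
      case (elim x)
      then have x: "x \<in> fst c" by simp
      have "sqrt \<kappa> * norm (to_chart A c x s) \<le> tnorm g x s" for s
      proof -
        have "\<kappa> * (norm (to_chart A c x s))\<^sup>2 \<le> g x s s"
          using conjunct2[OF elim, rule_format, of "to_chart A c x s"]
          by (simp add: metric_in_chart_def chart_inv_chart[OF c x] from_chart_to_chart[OF c x])
        then have "sqrt (\<kappa> * (norm (to_chart A c x s))\<^sup>2) \<le> tnorm g x s"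
          unfolding tnorm_def by (rule real_sqrt_le_mono)
        then show ?thesis by (simp add: real_sqrt_mult)
      qed
      with x show ?case by simp
    qed
  qed
qed

context riemannian_C2_function
begin

abbreviation "gnorm x \<equiv> tnorm g x (rgrad A g f x)"

lemma tnorm_nonneg: "0 \<le> tnorm g x v"
  by (simp add: tnorm_def spd_form_nonneg[OF metric_spd])

lemma tnorm_sq: "(tnorm g x v)\<^sup>2 = g x v v"
  by (simp add: tnorm_def spd_form_nonneg[OF metric_spd])

lemma tnorm_eq_0_iff: "tnorm g x v = 0 \<longleftrightarrow> v = 0"
  by (simp add: tnorm_def spd_form_eq_0_iff[OF metric_spd])

lemma Cauchy_Schwarz_tnorm: "\<bar>g x u v\<bar> \<le> tnorm g x u * tnorm g x v"
  unfolding tnorm_def by (rule spd_form_Cauchy_Schwarz[OF metric_spd])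

text \<open>A real \<open>SUP\<close> bounds its terms only if they are bounded above. This follows
  by comparing \<open>g x\<close> with the Euclidean norm from both sides.\<close>

lemma tnorm_le_tonorm:
  assumes T: "linear T"
  shows "tnorm g x (T v) \<le> tonorm g x T * tnorm g x v"
proof (cases "v = 0")
  case True
  then show ?thesis by (simp add: linear_0[OF T] tnorm_eq_0_iff[THEN iffD2])
next
  case False
  obtain \<kappa> where \<kappa>: "\<kappa> > 0" "\<And>u. \<kappa> * (norm u)\<^sup>2 \<le> g x u u"
    using spd_form_bounds[OF metric_spd] by blast
  have bl: "bilinear (g x)" using metric_spd by (simp add: spd_form_def)
  define K where "K = (\<Sum>i\<in>Basis. \<Sum>j\<in>Basis. \<bar>g x i j\<bar>)"
  have K0: "K \<ge> 0" by (simp add: K_def sum_nonneg)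
  have K: "g x u u \<le> K * (norm u)\<^sup>2" for u
    using bilinear_abs_le[OF bl, of u u] by (simp add: K_def power2_eq_square mult_ac)
  obtain B where B: "\<And>u. norm (T u) \<le> B * norm u" using linear_bounded[OF T] by blast
  have "tnorm g x (T u) / tnorm g x u \<le> sqrt (K * B\<^sup>2 / \<kappa>)" for u
  proof (cases "u = 0")
    case True
    then show ?thesis using \<kappa>(1) K0 by (simp add: linear_0[OF T] tnorm_eq_0_iff[THEN iffD2])
  next
    case False
    then have p: "g x u u > 0" using metric_spd by (simp add: spd_form_def)
    have "g x (T u) (T u) \<le> K * (B * norm u)\<^sup>2"
      by (intro order_trans[OF K] mult_left_mono power_mono B K0) simp
    also have "\<dots> = K * B\<^sup>2 / \<kappa> * (\<kappa> * (norm u)\<^sup>2)" using \<kappa>(1) by (simp add: power_mult_distrib)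
    also have "\<dots> \<le> K * B\<^sup>2 / \<kappa> * g x u u" using \<kappa> K0 by (intro mult_left_mono) auto
    finally have "g x (T u) (T u) / g x u u \<le> K * B\<^sup>2 / \<kappa>" using p by (simp add: pos_divide_le_eq)
    then show ?thesis unfolding tnorm_def real_sqrt_divide[symmetric] by (rule real_sqrt_le_mono)
  qed
  then have "bdd_above (range (\<lambda>u. tnorm g x (T u) / tnorm g x u))" by (auto intro!: bdd_aboveI)
  then have "tnorm g x (T v) / tnorm g x v \<le> tonorm g x T"
    unfolding tonorm_def by (rule cSUP_upper[OF UNIV_I])
  moreover have "tnorm g x v > 0" using False tnorm_eq_0_iff tnorm_nonneg by (metis less_le)
  ultimately show ?thesis by (simp add: pos_divide_le_eq)
qed

text \<open>The squared norm is \<open>df\<close> applied to the gradient components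
  \<open>?V\<close>, hence at most \<open>N * norm ?V \<le> N * gnorm / \<kappa>\<close>. Cancelling
  one factor leaves \<open>gnorm \<le> N / \<kappa>\<close>, and \<open>N\<close> tends to 0 because
  \<open>df\<close> is continuous and vanishes at the minimum.\<close>

lemma gnorm_tendsto_0:
  assumes "x0 \<in> local_minima f"
  shows "(gnorm \<longlongrightarrow> 0) (nhds x0)"
proof -
  define c where "c = chart_at A x0"
  define y0 where "y0 = snd c x0"
  have c: "c \<in> A" and x0: "x0 \<in> fst c" using chart_at by (auto simp: c_def)
  have y0: "y0 \<in> snd c ` fst c" using x0 by (simp add: y0_def)
  obtain \<kappa> where \<kappa>: "\<kappa> > 0"
    "\<forall>\<^sub>F x in nhds x0. x \<in> fst c \<and> (\<forall>s. \<kappa> * norm (to_chart A c x s) \<le> tnorm g x s)"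
    using tnorm_ge_chart[OF c x0] by blast
  have "\<forall>\<^sub>F x in nhds x0. f x0 \<le> f x" using assms by (simp add: local_minima_def)
  from eventually_chart_cball[OF c x0 this]
  obtain r where r: "r > 0" "cball y0 r \<subseteq> snd c ` fst c"
    "\<And>x. x \<in> fst c \<Longrightarrow> norm (snd c x - y0) \<le> r \<Longrightarrow> f x0 \<le> f x"
    unfolding y0_def by blast
  have "df c y0 = (\<lambda>w. 0)"
  proof (rule differential_zero_maxmin)
    show "y0 \<in> ball y0 r" "open (ball y0 r)" using r by auto
    show "((f \<circ> chart_inv c) has_derivative df c y0) (at y0)"
      using function_differentiable[OF c y0] by (simp add: frechet_derivative_works)
    have "(f \<circ> chart_inv c) y0 \<le> (f \<circ> chart_inv c) y" if "y \<in> ball y0 r" for y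
    proof -
      have y: "y \<in> snd c ` fst c" using that r(2) by auto
      have "f x0 \<le> f (chart_inv c y)"
        using that by (intro r(3) chart_inv_in_domain[OF c y])
          (simp add: chart_chart_inv[OF c y] dist_norm norm_minus_commute)
      then show ?thesis by (simp add: y0_def chart_inv_chart[OF c x0])
    qed
    then show "(\<forall>y\<in>ball y0 r. (f \<circ> chart_inv c) y \<le> (f \<circ> chart_inv c) y0) \<or>
      (\<forall>y\<in>ball y0 r. (f \<circ> chart_inv c) y0 \<le> (f \<circ> chart_inv c) y)" by blast
  qed
  then have z: "df c y0 w = 0" for w by meson
  define N where "N y = (\<Sum>i\<in>Basis. \<bar>df c y i\<bar>)" for y
  have "isCont (\<lambda>y. df c y w) y0" for w
    using df_differentiable[OF c y0] by (rule differentiable_imp_continuous_within)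
  then have "((\<lambda>y. df c y w) \<longlongrightarrow> df c y0 w) (nhds y0)" for w
    by (simp add: isCont_def tendsto_nhds_iff)
  then have "(N \<longlongrightarrow> N y0) (nhds y0)" unfolding N_def by (intro tendsto_intros)
  then have "((\<lambda>x. N (snd c x)) \<longlongrightarrow> N y0) (nhds x0)"
    by (rule filterlim_compose[OF _ tendsto_chart[OF c x0, folded y0_def]])
  then have "((\<lambda>x. N (snd c x) / \<kappa>) \<longlongrightarrow> N y0 / \<kappa>) (nhds x0)"
    using \<kappa>(1) by (intro tendsto_intros) auto
  then have lim: "((\<lambda>x. N (snd c x) / \<kappa>) \<longlongrightarrow> 0) (nhds x0)" by (simp add: N_def z)
  have "\<forall>\<^sub>F x in nhds x0. norm (gnorm x) \<le> N (snd c x) / \<kappa>"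
    using \<kappa>(2)
  proof eventually_elim
    case (elim x)
    then have x: "x \<in> fst c" by simp
    then have y: "snd c x \<in> snd c ` fst c" by simp
    let ?V = "chart_grad c (snd c x)"
    have V: "?V = to_chart A c x (rgrad A g f x)" by (simp add: chart_grad_def chart_inv_chart[OF c x])
    have "(gnorm x)\<^sup>2 = df c (snd c x) ?V"
      using grad_sq_in_chart[OF c y] by (simp add: tnorm_sq metric_chart_grad[OF c y] chart_inv_chart[OF c x])
    also have "\<dots> \<le> N (snd c x) * norm ?V"
      using linear_abs_le[OF linear_df[OF c y], of ?V] by (simp add: N_def)
    also have "\<dots> \<le> N (snd c x) * (gnorm x / \<kappa>)"
      using elim \<kappa>(1) unfolding V
      by (intro mult_left_mono) (auto simp: pos_le_divide_eq mult.commute N_def sum_nonneg)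
    finally have le: "gnorm x * gnorm x \<le> N (snd c x) / \<kappa> * gnorm x" by (simp add: power2_eq_square)
    have "N (snd c x) / \<kappa> \<ge> 0" using \<kappa>(1) by (simp add: N_def sum_nonneg)
    then have "gnorm x \<le> N (snd c x) / \<kappa>"
      using mult_right_le_imp_le[OF le] by (cases "gnorm x > 0") simp_all
    then show ?case using tnorm_nonneg by simp
  qed
  then show ?thesis using lim by (rule Lim_null_comparison)
qed

text \<open>In a fixed chart the quantity is a quadratic expression in the gradient components
  \<open>V\<close> minus half a cubic one, with continuous coefficients. Since
  \<open>gnorm x < 1\<close> near the minimum, one factor of the cubic term is absorbed in the
  constant.\<close>

lemma rhess_grad_bound:
  assumes x0: "x0 \<in> local_minima f"
  obtains C where "\<forall>\<^sub>F x in nhds x0. \<bar>g x (rgrad A g f x) (rhess A g f x (rgrad A g f x))\<bar> \<le> C * (gnorm x)\<^sup>2"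
proof -
  define c where "c = chart_at A x0"
  define y0 where "y0 = snd c x0"
  have c: "c \<in> A" and x0c: "x0 \<in> fst c" using chart_at by (auto simp: c_def)
  have y0: "y0 \<in> snd c ` fst c" using x0c by (simp add: y0_def)
  obtain \<kappa> where \<kappa>: "\<kappa> > 0"
    "\<forall>\<^sub>F x in nhds x0. x \<in> fst c \<and> (\<forall>s. \<kappa> * norm (to_chart A c x s) \<le> tnorm g x s)"
    using tnorm_ge_chart[OF c x0c] by blast
  define B2 where "B2 y = (\<Sum>i\<in>Basis. \<Sum>j\<in>Basis. \<bar>d2f c y i j\<bar>)" for y
  define B3 where "B3 y = (\<Sum>k\<in>Basis. \<Sum>i\<in>Basis. \<Sum>j\<in>Basis. \<bar>dmetric c y i j k\<bar>)" for y
  have "isCont (\<lambda>y. d2f c y w u) y0" "isCont (\<lambda>y. dmetric c y v w u) y0" for u v w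
    using continuous_on_d2f[OF c] continuous_on_dmetric[OF c] y0
    unfolding continuous_on_eq_continuous_at[OF open_chart_image[OF c]] by blast+
  then have lim: "((\<lambda>y. d2f c y w u) \<longlongrightarrow> d2f c y0 w u) (nhds y0)"
    "((\<lambda>y. dmetric c y v w u) \<longlongrightarrow> dmetric c y0 v w u) (nhds y0)" for u v w
    by (simp_all add: isCont_def tendsto_nhds_iff)
  have "(B2 \<longlongrightarrow> B2 y0) (nhds y0)" "(B3 \<longlongrightarrow> B3 y0) (nhds y0)"
    unfolding B2_def B3_def by (intro tendsto_intros lim)+
  then have "\<forall>\<^sub>F y in nhds y0. B2 y < B2 y0 + 1" "\<forall>\<^sub>F y in nhds y0. B3 y < B3 y0 + 1"
    by (auto intro: order_tendstoD)
  then have ev: "\<forall>\<^sub>F y in nhds y0. B2 y < B2 y0 + 1 \<and> B3 y < B3 y0 + 1" by (rule eventually_conj)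
  have small: "\<forall>\<^sub>F x in nhds x0. gnorm x < 1"
    using gnorm_tendsto_0[OF x0] by (rule order_tendstoD) simp
  \<comment> \<open>\<open>B2 y0 + 1\<close> and \<open>B3 y0 + 1\<close> bound the coefficients
    nearby; \<open>1 / \<kappa>\<close> pays for the third factor of the cubic term, and
    \<open>\<kappa>\<^sup>2\<close> for passing from \<open>norm V\<close> to
    \<open>gnorm x\<close>.\<close>
  define C where "C = (B2 y0 + 1 + (B3 y0 + 1) / \<kappa>) / \<kappa>\<^sup>2"
  have "\<forall>\<^sub>F x in nhds x0. \<bar>g x (rgrad A g f x) (rhess A g f x (rgrad A g f x))\<bar> \<le> C * (gnorm x)\<^sup>2"
    using \<kappa>(2) small eventually_nhds_chart[OF c x0c ev[unfolded y0_def], folded y0_def]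
  proof eventually_elim
    case (elim x)
    then have x: "x \<in> fst c" by simp
    let ?y = "snd c x"
    have y: "?y \<in> snd c ` fst c" using x by simp
    define V where "V = chart_grad c ?y"
    have V: "V = to_chart A c x (rgrad A g f x)" by (simp add: V_def chart_grad_def chart_inv_chart[OF c x])
    have fV: "from_chart A c x V = rgrad A g f x" unfolding V by (rule from_chart_to_chart[OF c x])
    have nV: "norm V \<le> gnorm x / \<kappa>" using elim(1) \<kappa>(1) unfolding V by (simp add: pos_le_divide_eq mult.commute)
    then have nV1: "norm V \<le> 1 / \<kappa>" using elim(2) \<kappa>(1)
      by (meson divide_right_mono less_imp_le order_trans)
    have b2: "\<bar>d2f c ?y V V\<bar> \<le> (B2 y0 + 1) * (norm V)\<^sup>2"
    proof -
      have "\<bar>d2f c ?y V V\<bar> \<le> B2 ?y * (norm V)\<^sup>2"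
        using bilinear_abs_le[OF bilinear_d2f[OF c y], of V V] by (simp add: B2_def power2_eq_square mult_ac)
      also have "\<dots> \<le> (B2 y0 + 1) * (norm V)\<^sup>2" using elim(3) by (intro mult_right_mono) auto
      finally show ?thesis .
    qed
    have b3: "\<bar>dmetric c ?y V V V\<bar> \<le> (B3 y0 + 1) / \<kappa> * (norm V)\<^sup>2"
    proof -
      have "\<bar>dmetric c ?y V V V\<bar> \<le> (\<Sum>k\<in>Basis. \<bar>dmetric c ?y V V k\<bar>) * norm V"
        by (rule linear_abs_le[OF linear_dmetric[OF c y]])
      also have "(\<Sum>k\<in>Basis. \<bar>dmetric c ?y V V k\<bar>) \<le>
          (\<Sum>k\<in>Basis. (\<Sum>i\<in>Basis. \<Sum>j\<in>Basis. \<bar>dmetric c ?y i j k\<bar>) * norm V * norm V)"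
        by (intro sum_mono bilinear_abs_le[OF bilinear_dmetric[OF c y]])
      also have "\<dots> = B3 ?y * (norm V)\<^sup>2"
        by (simp only: B3_def sum_distrib_right power2_eq_square mult.assoc)
      finally have "\<bar>dmetric c ?y V V V\<bar> \<le> B3 ?y * (norm V)\<^sup>2 * norm V"
        by (simp add: mult_right_mono)
      also have "\<dots> \<le> (B3 y0 + 1) * (norm V)\<^sup>2 * (1 / \<kappa>)"
        using elim(3) nV1
        by (intro mult_mono mult_right_mono) (auto simp: B3_def sum_nonneg add_nonneg_nonneg)
      finally show ?thesis by (simp add: mult_ac)
    qed
    have "\<bar>g x (rgrad A g f x) (rhess A g f x (rgrad A g f x))\<bar> \<le> \<bar>d2f c ?y V V\<bar> + \<bar>dmetric c ?y V V V\<bar>"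
      using rhess_grad_in_chart[OF c x, of V] unfolding fV V_def[symmetric] by linarith
    also have "\<dots> \<le> (B2 y0 + 1 + (B3 y0 + 1) / \<kappa>) * (norm V)\<^sup>2"
      using b2 b3 by (simp add: distrib_right)
    also have "\<dots> \<le> (B2 y0 + 1 + (B3 y0 + 1) / \<kappa>) * (gnorm x / \<kappa>)\<^sup>2"
      using nV \<kappa>(1)
      by (intro mult_left_mono power_mono) (auto simp: B2_def B3_def sum_nonneg add_nonneg_nonneg)
    finally show ?case by (simp add: C_def power_divide)
  qed
  then show ?thesis by (rule that)
qed

text \<open>In the bundle chart the retraction is continuously differentiable, hence Lipschitz on a
  small ball around \<open>(y0, 0)\<close>. Comparing \<open>(y, u)\<close> with
  \<open>(y, 0)\<close>, which is mapped to \<open>y\<close>, gives a bound uniform in the base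
  point.\<close>

lemma retraction_displacement:
  assumes R: "is_retraction A R" and c: "c \<in> A" and x0: "x0 \<in> fst c"
  obtains C \<delta> where "C > 0" "\<delta> > 0"
    "\<forall>\<^sub>F x in nhds x0. \<forall>s. tnorm g x s \<le> \<delta> \<longrightarrow>
       R x s \<in> fst c \<and> norm (snd c (R x s) - snd c x) \<le> C * tnorm g x s"
proof -
  let ?\<Psi> = "bundle_rep A R c"
  define y0 where "y0 = snd c x0"
  have y0: "y0 \<in> snd c ` fst c" using x0 by (simp add: y0_def)
  have rep: "?\<Psi> (snd c x, to_chart A c x s) = R x s" if "x \<in> fst c" for x s
    by (simp add: bundle_rep_def chart_inv_chart[OF c that] from_chart_to_chart[OF c that])
  have rep0: "?\<Psi> (snd c x, 0) = x" if "x \<in> fst c" for x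
    using R rep[OF that, of 0] linear_0[OF linear_to_chart[OF c that]] by (simp add: is_retraction_def)
  \<comment> \<open>The bundle points that \<open>R\<close> sends back into the chart: an open set,
    by continuity of the bundle representation, which contains \<open>(y0, 0)\<close>.\<close>
  define S where "S = {p \<in> snd c ` fst c \<times> UNIV. ?\<Psi> p \<in> fst c}"
  define \<Phi> where "\<Phi> = snd c \<circ> ?\<Psi>"
  have "S = (snd c ` fst c \<times> UNIV) \<inter> ?\<Psi> -` fst c" by (auto simp: S_def)
  moreover have "continuous_on (snd c ` fst c \<times> UNIV) ?\<Psi>" using R c by (simp add: is_retraction_def)
  ultimately have openS: "open S"
    using continuous_open_preimage[OF _ _ open_chart_domain[OF c]] open_Times[OF open_chart_image[OF c] open_UNIV]
    by simp
  have "Ck_on (Suc 0) \<Phi> S"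
    using R c unfolding is_retraction_def smooth_on_def S_def \<Phi>_def by blast
  then have diff: "\<And>p. p \<in> S \<Longrightarrow> (\<Phi> has_derivative frechet_derivative \<Phi> (at p)) (at p)"
    and cont: "\<And>v. continuous_on S (\<lambda>p. frechet_derivative \<Phi> (at p) v)"
    by (auto simp: frechet_derivative_works)
  define p0 where "p0 = (y0, 0 :: 'e)"
  have p0: "p0 \<in> S" using x0 y0 rep0[OF x0] by (simp add: S_def p0_def y0_def)
  define B where "B p = (\<Sum>i\<in>Basis. norm (frechet_derivative \<Phi> (at p) i))" for p
  have "continuous_on S B" unfolding B_def by (intro continuous_intros cont)
  then have "isCont B p0" using openS p0 by (simp add: continuous_on_eq_continuous_at)
  then have "(B \<longlongrightarrow> B p0) (nhds p0)" by (simp add: isCont_def tendsto_nhds_iff)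
  then have "\<forall>\<^sub>F p in nhds p0. B p < B p0 + 1" by (rule order_tendstoD) simp
  moreover have "\<forall>\<^sub>F p in nhds p0. p \<in> S" using openS p0 by (simp add: eventually_nhds_in_open)
  ultimately have "\<forall>\<^sub>F p in nhds p0. B p < B p0 + 1 \<and> p \<in> S" by (rule eventually_conj)
  then obtain e where e: "e > 0" "\<And>p. dist p p0 < e \<Longrightarrow> B p < B p0 + 1 \<and> p \<in> S"
    by (auto simp: eventually_nhds_metric)
  have Lip: "norm (\<Phi> p - \<Phi> q) \<le> (B p0 + 1) * norm (p - q)" if "p \<in> ball p0 e" "q \<in> ball p0 e" for p q
  proof (rule differentiable_bound[OF convex_ball _ _ that])
    fix r assume r: "r \<in> ball p0 e"
    then have rS: "r \<in> S" "B r < B p0 + 1" using e(2)[of r] by (auto simp: dist_commute)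
    show "(\<Phi> has_derivative frechet_derivative \<Phi> (at r)) (at r within ball p0 e)"
      using diff[OF rS(1)] by (rule has_derivative_at_withinI)
    have lin: "linear (frechet_derivative \<Phi> (at r))"
      using diff[OF rS(1)] by (rule has_derivative_linear)
    have "norm (frechet_derivative \<Phi> (at r) v) \<le> B r * norm v" for v
    proof -
      have "frechet_derivative \<Phi> (at r) v = (\<Sum>i\<in>Basis. (v \<bullet> i) *\<^sub>R frechet_derivative \<Phi> (at r) i)"
        by (subst euclidean_representation[of v, symmetric])
          (simp add: linear_sum[OF lin] linear_scale[OF lin])
      also have "norm \<dots> \<le> (\<Sum>i\<in>Basis. norm v * norm (frechet_derivative \<Phi> (at r) i))"
        by (intro sum_norm_le) (simp add: mult_right_mono Basis_le_norm)
      finally show ?thesis by (simp add: B_def sum_distrib_left mult.commute)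
    qed
    then have "onorm (frechet_derivative \<Phi> (at r)) \<le> B r"
      by (rule onorm_bound[rotated]) (simp add: B_def sum_nonneg)
    then show "onorm (frechet_derivative \<Phi> (at r)) \<le> B p0 + 1" using rS(2) by simp
  qed
  obtain \<kappa> where \<kappa>: "\<kappa> > 0"
    "\<forall>\<^sub>F x in nhds x0. x \<in> fst c \<and> (\<forall>s. \<kappa> * norm (to_chart A c x s) \<le> tnorm g x s)"
    using tnorm_ge_chart[OF c x0] by blast
  have near: "\<forall>\<^sub>F y in nhds y0. dist y y0 < e / 2"
    unfolding eventually_nhds_metric using e(1) by (intro exI[of _ "e / 2"]) auto
  have B1: "B p0 + 1 > 0" by (simp add: B_def sum_nonneg add_nonneg_pos)
  show ?thesis
  proof
    \<comment> \<open>The radius \<open>\<kappa> * e / 4\<close> forces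
      \<open>norm ?u \<le> e / 4\<close>; with the base point within \<open>e / 2\<close> of
      \<open>y0\<close>, both bundle points lie in the ball of radius \<open>e\<close>.\<close>
    show "(B p0 + 1) / \<kappa> > 0" "\<kappa> * e / 4 > 0" using B1 \<kappa>(1) e(1) by auto
    show "\<forall>\<^sub>F x in nhds x0. \<forall>s. tnorm g x s \<le> \<kappa> * e / 4 \<longrightarrow>
       R x s \<in> fst c \<and> norm (snd c (R x s) - snd c x) \<le> (B p0 + 1) / \<kappa> * tnorm g x s"
      using \<kappa>(2) eventually_nhds_chart[OF c x0 near[unfolded y0_def], folded y0_def]
    proof eventually_elim
      case (elim x)
      then have x: "x \<in> fst c" by simp
      show ?case
      proof (intro allI impI)
        fix s assume s: "tnorm g x s \<le> \<kappa> * e / 4"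
        let ?u = "to_chart A c x s"
        have u: "norm ?u \<le> tnorm g x s / \<kappa>" using elim(1) \<kappa>(1) by (simp add: pos_le_divide_eq mult.commute)
        also have "\<dots> \<le> e / 4" using s \<kappa>(1) by (simp add: pos_divide_le_eq mult.commute)
        finally have ue: "norm ?u \<le> e / 4" .
        have inball: "(snd c x, w) \<in> ball p0 e" if "norm w \<le> e / 4" for w
        proof -
          have "dist (snd c x, w) p0 \<le> dist (snd c x) y0 + norm w"
            using sqrt_sum_squares_le_sum[of "dist (snd c x) y0" "norm w"]
            by (simp add: p0_def dist_Pair_Pair)
          also have "\<dots> < e" using elim(2) that e(1) by linarith
          finally show ?thesis by (simp add: dist_commute)
        qed
        have b1: "(snd c x, ?u) \<in> ball p0 e" and b2: "(snd c x, 0) \<in> ball p0 e"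
          by (rule inball, use ue e(1) in simp)+
        then have "(snd c x, ?u) \<in> S" using e(2) by (auto simp: dist_commute)
        then have in_c: "R x s \<in> fst c" by (simp add: S_def rep[OF x])
        have "norm (snd c (R x s) - snd c x) = norm (\<Phi> (snd c x, ?u) - \<Phi> (snd c x, 0))"
          by (simp add: \<Phi>_def rep[OF x] rep0[OF x])
        also have "\<dots> \<le> (B p0 + 1) * norm ((snd c x, ?u) - (snd c x, 0))" by (rule Lip[OF b1 b2])
        also have "norm ((snd c x, ?u) - (snd c x, 0)) = norm ?u" by (simp add: norm_Pair)
        also have "(B p0 + 1) * norm ?u \<le> (B p0 + 1) * (tnorm g x s / \<kappa>)"
          using u B1 by (intro mult_left_mono) auto
        finally show "R x s \<in> fst c \<and> norm (snd c (R x s) - snd c x) \<le> (B p0 + 1) / \<kappa> * tnorm g x s"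
          using in_c by simp
      qed
    qed
  qed
qed

end


section \<open>One step of the trust-region method\<close>

text \<open>\<open>a\<close> and \<open>b\<close> are the gaps to the minimal value before and after
  a step of length \<open>t\<close>. On the one hand
  \<open>a - b \<le> 2 * sqrt a * (sqrt a - sqrt b)\<close>; on the other, \<open>PL\<close> bounds
  \<open>G\<close> below by a multiple of \<open>sqrt a\<close>. The factor \<open>sqrt a\<close>
  cancels.\<close>

lemma step_le_sqrt_diff:
  fixes a b G t \<sigma> \<mu> :: real
  assumes "0 \<le> b" "0 \<le> t" "0 \<le> G" "0 < \<sigma>" "0 < \<mu>"
    and dec: "\<sigma> * G * t \<le> a - b" and PL: "a \<le> 1 / (2 * \<mu>) * G\<^sup>2" and t: "t \<le> c * G"
  shows "t \<le> 2 / (\<sigma> * sqrt (2 * \<mu>)) * (sqrt a - sqrt b)"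
proof -
  have "\<sigma> * G * t \<ge> 0" using assms by simp
  then have ab: "b \<le> a" using dec by simp
  have "2 * \<mu> * a \<le> G\<^sup>2" using PL assms(5) by (simp add: field_simps)
  then have "sqrt (2 * \<mu> * a) \<le> G" using assms(3) by (simp add: real_le_lsqrt)
  then have G: "sqrt (2 * \<mu>) * sqrt a \<le> G" by (simp add: real_sqrt_mult)
  have p: "\<sigma> * sqrt (2 * \<mu>) > 0" using assms by simp
  show ?thesis
  proof (cases "a > 0")
    case True
    have "\<sigma> * sqrt (2 * \<mu>) * t * sqrt a \<le> \<sigma> * G * t"
      using mult_left_mono[OF G, of "\<sigma> * t"] assms by (simp add: mult_ac)
    also have "\<dots> \<le> a - b" by (rule dec)
    also have "a - b = (sqrt a - sqrt b) * (sqrt a + sqrt b)"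
      using assms(1) ab by (simp add: algebra_simps)
    also have "\<dots> \<le> (sqrt a - sqrt b) * (2 * sqrt a)"
      using ab by (intro mult_left_mono) auto
    finally have "\<sigma> * sqrt (2 * \<mu>) * t * sqrt a \<le> 2 * (sqrt a - sqrt b) * sqrt a" by (simp add: mult_ac)
    then have "\<sigma> * sqrt (2 * \<mu>) * t \<le> 2 * (sqrt a - sqrt b)"
      using True by (simp add: mult_le_cancel_right_pos)
    then show ?thesis using p by (simp add: pos_le_divide_eq mult.commute)
  next
    case False
    \<comment> \<open>With a zero gap nothing can be cancelled. Then \<open>G * t = 0\<close>, and
      \<open>t \<le> c * G\<close> yields \<open>t = 0\<close> even if \<open>G\<close> is the
      vanishing factor.\<close>
    then have "a = 0" "b = 0" using ab assms(1) by auto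
    then have "\<sigma> * G * t = 0" using dec \<open>\<sigma> * G * t \<ge> 0\<close> by simp
    then have "t = 0" using t assms by auto
    then show ?thesis using \<open>a = 0\<close> \<open>b = 0\<close> by simp
  qed
qed

text \<open>\<open>D\<close> is the model decrease and \<open>F\<close> the actual one.  Since \<open>t \<le> c1 * G\<close>, the model error is
  at most \<open>t\<close> times a multiple of \<open>G * t\<close>, whereas \<open>D\<close> is at least a fixed multiple of \<open>G * t\<close>.\<close>

lemma actual_decrease_ge:
  fixes D F G K L \<beta> \<Delta> c0 c1 q t :: real
  assumes K: "K \<ge> 1" and G: "0 \<le> G" and \<Delta>: "0 < \<Delta>" and t: "0 \<le> t" "t \<le> \<Delta>" "t \<le> c1 * G"
    and c: "c0 > 0" "c1 \<ge> 1" "\<beta> \<ge> 0" "L \<ge> 0"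
    and q: "0 \<le> q" "q \<le> K * G\<^sup>2"
    and D: "c0 * G * (if q = 0 then \<Delta> else min \<Delta> (G ^ 3 / q)) \<le> D"
    and F: "D - 1 / 2 * \<beta> * G * t\<^sup>2 - L / 6 * t ^ 3 \<le> F"
    and small: "(\<beta> / 2 + L * c1 / 6) * (c1 * G) \<le> 3 / 4 * (c0 / (c1 * K))"
  shows "c0 * G * min \<Delta> (G / K) \<le> D" "D / 4 \<le> F" "c0 / (c1 * K) * G * t \<le> D"
proof -
  \<comment> \<open>The curvature bound gives \<open>G ^ 3 / q \<ge> G / K\<close>; for
    \<open>q = 0\<close> the quotient counts as infinite and \<Delta> alone remains.\<close>
  have "min \<Delta> (G / K) \<le> (if q = 0 then \<Delta> else min \<Delta> (G ^ 3 / q))"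
  proof (cases "q = 0")
    case False
    then have qp: "q > 0" using q by simp
    have "q * G \<le> K * G\<^sup>2 * G" by (rule mult_right_mono[OF q(2) G])
    then have "G / K \<le> G ^ 3 / q" using qp K by (simp add: field_simps power2_eq_square power3_eq_cube)
    then show ?thesis using False by auto
  qed simp
  then have "c0 * G * min \<Delta> (G / K) \<le> c0 * G * (if q = 0 then \<Delta> else min \<Delta> (G ^ 3 / q))"
    using c G by (intro mult_left_mono) auto
  with D show D1: "c0 * G * min \<Delta> (G / K) \<le> D" by linarith
  have "t / K \<le> c1 * G / K" using t K by (intro divide_right_mono) auto
  then have tG: "t / (c1 * K) \<le> G / K" using c K by (simp add: field_simps)
  \<comment> \<open>\<open>t / (c1 * K)\<close> must lie below \<Delta> as well as below
    \<open>G / K\<close>; the former combines \<open>t \<le> \<Delta>\<close> with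
    \<open>c1 * K \<ge> 1\<close>.\<close>
  have "c1 * K \<ge> 1 * 1" using c K by (intro mult_mono) auto
  then have "t / (c1 * K) \<le> t / 1" using t by (intro divide_left_mono) auto
  with tG t have "t / (c1 * K) \<le> min \<Delta> (G / K)" by simp
  then have "c0 * G * (t / (c1 * K)) \<le> c0 * G * min \<Delta> (G / K)"
    using c G by (intro mult_left_mono) auto
  with D1 show D2: "c0 / (c1 * K) * G * t \<le> D" by (simp add: mult_ac)
  \<comment> \<open>\<open>t \<le> c1 * G\<close> is spent twice: to reduce the cubic term to a
    quadratic one, and to turn one more factor \<open>t\<close> into \<open>c1 * G\<close>, where
    \<open>small\<close> applies. At most \<open>3 / 4 * D\<close> is lost, and the quarter left is
    the ratio below which the radius would shrink.\<close>
  have "1 / 2 * \<beta> * G * t\<^sup>2 + L / 6 * t ^ 3 \<le> 1 / 2 * \<beta> * G * t\<^sup>2 + L / 6 * (t\<^sup>2 * (c1 * G))"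
    using t c by (intro add_left_mono mult_left_mono) (simp_all add: power3_eq_cube power2_eq_square mult_left_mono)
  also have "\<dots> = (\<beta> / 2 + L * c1 / 6) * t * (G * t)" by (simp add: power2_eq_square algebra_simps)
  also have "\<dots> \<le> (\<beta> / 2 + L * c1 / 6) * (c1 * G) * (G * t)"
    using t c G by (intro mult_right_mono mult_left_mono) auto
  also have "\<dots> \<le> 3 / 4 * (c0 / (c1 * K)) * (G * t)"
    using t G by (intro mult_right_mono[OF small]) auto
  also have "\<dots> \<le> 3 / 4 * D"
    using mult_left_mono[OF D2, of "3 / 4"] by (simp only: mult.assoc)
  finally show "D / 4 \<le> F" using F by linarith
qed

context riemannian_C2_function
begin

text \<open>The assumptions on one iteration, detached from the run, so that the local analysis can
  range over all radii, maps and steps at a point.\<close>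

definition tr_step :: "real \<Rightarrow> real \<Rightarrow> real \<Rightarrow> 'm \<Rightarrow> real \<Rightarrow> ('e \<Rightarrow> 'e) \<Rightarrow> 'e \<Rightarrow> bool" where
  "tr_step \<beta> c0 c1 x \<Delta> H s \<longleftrightarrow> 0 < \<Delta> \<and> symmetric_map g x H \<and> tnorm g x s \<le> \<Delta> \<and>
     tonorm g x (\<lambda>v. H v - rhess A g f x v) \<le> \<beta> * gnorm x \<and>
     c0 * gnorm x * (let q = \<bar>g x (rgrad A g f x) (H (rgrad A g f x))\<bar> in
       if q = 0 then \<Delta> else min \<Delta> (gnorm x ^ 3 / q)) \<le> tr_model A g f x H 0 - tr_model A g f x H s \<and>
     tnorm g x s \<le> c1 * gnorm x"

text \<open>The constants and the neighbourhood are chosen before the radius, the map and the step,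
  so that one neighbourhood can serve every run. The lower bound on \<open>f (R x s)\<close> keeps
  the new gap nonnegative under its square root.\<close>

lemma tr_step_local:
  assumes R: "is_retraction A R" and xbar: "xbar \<in> local_minima f"
    and PL: "PL_around A g f \<mu> xbar" "\<mu> > 0"
    and L: "L \<ge> 0" and Taylor: "\<exists>\<delta>>0. \<forall>\<^sub>F x in nhds xbar. \<forall>s. tnorm g x s \<le> \<delta> \<longrightarrow>
           f (R x s) - f x - g x s (rgrad A g f x) - 1 / 2 * g x s (rhess A g f x s)
             \<le> L / 6 * tnorm g x s ^ 3"
    and c: "\<beta> \<ge> 0" "c0 > 0" "c1 \<ge> 1" "d \<in> A" "xbar \<in> fst d"
  obtains C a K where "C > 0" "a > 0" "K > 0"
    "\<forall>\<^sub>F x in nhds xbar. \<forall>\<Delta> H s. tr_step \<beta> c0 c1 x \<Delta> H s \<longrightarrow>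
       tr_ratio A g f R x H s \<ge> 1 / 4 \<and> R x s \<in> fst d \<and> f xbar \<le> f (R x s) \<and>
       a * gnorm x * min \<Delta> (gnorm x / K) \<le> f x - f (R x s) \<and>
       norm (snd d (R x s) - snd d x) \<le> C * (sqrt (f x - f xbar) - sqrt (f (R x s) - f xbar))"
proof -
  obtain Ch where Ch: "\<forall>\<^sub>F x in nhds xbar.
      \<bar>g x (rgrad A g f x) (rhess A g f x (rgrad A g f x))\<bar> \<le> Ch * (gnorm x)\<^sup>2"
    using rhess_grad_bound[OF xbar] by blast
  obtain CR \<delta>R where CR: "CR > 0" "\<delta>R > 0"
    "\<forall>\<^sub>F x in nhds xbar. \<forall>s. tnorm g x s \<le> \<delta>R \<longrightarrow>
       R x s \<in> fst d \<and> norm (snd d (R x s) - snd d x) \<le> CR * tnorm g x s"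
    using retraction_displacement[OF R c(4,5)] by blast
  obtain \<delta>L where \<delta>L: "\<delta>L > 0" "\<forall>\<^sub>F x in nhds xbar. \<forall>s. tnorm g x s \<le> \<delta>L \<longrightarrow>
           f (R x s) - f x - g x s (rgrad A g f x) - 1 / 2 * g x s (rhess A g f x s)
             \<le> L / 6 * tnorm g x s ^ 3"
    using Taylor by blast
  have min: "\<forall>\<^sub>F x in nhds xbar. f xbar \<le> f x" using xbar by (simp add: local_minima_def)
  obtain e where e: "e > 0" "\<And>x. x \<in> fst d \<Longrightarrow> norm (snd d x - snd d xbar) \<le> e \<Longrightarrow> f xbar \<le> f x"
    using eventually_chart_cball[OF c(4,5) min] by metis
  \<comment> \<open>In the gradient direction \<open>H\<close> differs from the Hessian by at most
    \<beta> times \<open>gnorm x \<le> 1\<close>, so its curvature is at most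
    \<open>Ch + \<beta>\<close>. The maximum ensures \<open>K \<ge> 1\<close> whatever the sign of
    \<open>Ch\<close>.\<close>
  define K where "K = max 1 (Ch + \<beta>)"
  define \<gamma> where "\<gamma> = c0 / (c1 * K)"
  have K: "K \<ge> 1" and \<gamma>: "\<gamma> > 0" using c by (simp_all add: K_def \<gamma>_def)
  \<comment> \<open>In order: 1 serves the choice of \<open>K\<close>; the next two bring steps of
    length \<open>c1 * gnorm x\<close> into the range of the retraction and Taylor bounds; the
    fourth keeps the new point where \<open>f \<ge> f xbar\<close>; the last limits the model error
    to three quarters of the decrease, its \<open>+ 1\<close> keeping the denominator
    positive.\<close>
  define \<epsilon> where "\<epsilon> = Min {1, \<delta>R / c1, \<delta>L / c1, e / (2 * CR * c1),
      3 / 4 * \<gamma> / ((\<beta> / 2 + L * c1 / 6 + 1) * c1)}"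
  have B: "(\<beta> / 2 + L * c1 / 6 + 1) * c1 > 0" using c L by (simp add: add_nonneg_pos)
  have "\<epsilon> > 0" using c CR(1,2) \<delta>L(1) e(1) \<gamma> B by (simp add: \<epsilon>_def)
  then have small: "\<forall>\<^sub>F x in nhds xbar. gnorm x < \<epsilon>"
    by (rule order_tendstoD(2)[OF gnorm_tendsto_0[OF xbar]])
  have "\<forall>\<^sub>F y in nhds (snd d xbar). dist y (snd d xbar) < e / 2"
    unfolding eventually_nhds_metric using e(1) by (intro exI[of _ "e / 2"]) auto
  from eventually_nhds_chart[OF c(4,5) this]
  have near: "\<forall>\<^sub>F x in nhds xbar. norm (snd d x - snd d xbar) < e / 2"
    by eventually_elim (simp add: dist_norm)
  \<comment> \<open>\<open>CR\<close> times the constant of \<open>step_le_sqrt_diff\<close> for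
    \<open>\<sigma> = \<gamma> / 4\<close>: the model decreases by at least
    \<open>\<gamma> * G * t\<close>, and \<open>f\<close> by a quarter of that.\<close>
  define C where "C = CR * (2 / (\<gamma> / 4 * sqrt (2 * \<mu>)))"
  show ?thesis
  proof
    show "C > 0" "c0 / 4 > 0" "K > 0" using CR(1) \<gamma> PL(2) c K by (auto simp: C_def)
    show "\<forall>\<^sub>F x in nhds xbar. \<forall>\<Delta> H s. tr_step \<beta> c0 c1 x \<Delta> H s \<longrightarrow>
       tr_ratio A g f R x H s \<ge> 1 / 4 \<and> R x s \<in> fst d \<and> f xbar \<le> f (R x s) \<and>
       c0 / 4 * gnorm x * min \<Delta> (gnorm x / K) \<le> f x - f (R x s) \<and>
       norm (snd d (R x s) - snd d x) \<le> C * (sqrt (f x - f xbar) - sqrt (f (R x s) - f xbar))"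
      using Ch CR(3) \<delta>L(2) small near PL(1)[unfolded PL_around_def]
    proof eventually_elim
      case (elim x)
      show ?case
      proof (intro allI impI)
        fix \<Delta> H s assume step: "tr_step \<beta> c0 c1 x \<Delta> H s"
        let ?G = "rgrad A g f x" and ?T = "\<lambda>v. H v - rhess A g f x v"
        define G where "G = gnorm x"
        define t where "t = tnorm g x s"
        define q where "q = \<bar>g x ?G (H ?G)\<bar>"
        define D where "D = tr_model A g f x H 0 - tr_model A g f x H s"
        define F where "F = f x - f (R x s)"
        have bl: "bilinear (g x)" using metric_spd by (simp add: spd_form_def)
        have lH: "linear H" using step by (simp add: tr_step_def symmetric_map_def)
        have lT: "linear ?T" by (intro linear_compose_sub lH linear_rhess)
        have T: "\<bar>g x v (?T v)\<bar> \<le> \<beta> * G * (tnorm g x v)\<^sup>2" for v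
        proof -
          have "tnorm g x (?T v) \<le> tonorm g x ?T * tnorm g x v" by (rule tnorm_le_tonorm[OF lT])
          also have "\<dots> \<le> \<beta> * G * tnorm g x v"
            using step by (intro mult_right_mono tnorm_nonneg) (simp add: tr_step_def G_def)
          finally have "tnorm g x v * tnorm g x (?T v) \<le> tnorm g x v * (\<beta> * G * tnorm g x v)"
            by (intro mult_left_mono tnorm_nonneg)
          then show ?thesis
            using Cauchy_Schwarz_tnorm[of x v "?T v"] by (simp add: power2_eq_square mult_ac)
        qed
        have G: "0 \<le> G" "G < \<epsilon>" using elim(4) by (simp_all add: G_def tnorm_nonneg)
        have t: "0 \<le> t" "t \<le> \<Delta>" "t \<le> c1 * G"
          using step by (simp_all add: t_def G_def tnorm_nonneg tr_step_def)
        have "G \<le> 1" "G \<le> \<delta>R / c1" "G \<le> \<delta>L / c1" "G \<le> e / (2 * CR * c1)"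
          and b5: "G \<le> 3 / 4 * \<gamma> / ((\<beta> / 2 + L * c1 / 6 + 1) * c1)"
          using G(2) by (simp_all add: \<epsilon>_def)
        then have b: "G \<le> 1" "c1 * G \<le> \<delta>R" "c1 * G \<le> \<delta>L" "CR * (c1 * G) \<le> e / 2"
          using c CR(1) by (simp_all add: pos_le_divide_eq mult_ac)
        have "(\<beta> / 2 + L * c1 / 6) * (c1 * G) \<le> (\<beta> / 2 + L * c1 / 6 + 1) * (c1 * G)"
          using c G by (intro mult_right_mono) auto
        also have "\<dots> \<le> 3 / 4 * \<gamma>"
          using b5 unfolding pos_le_divide_eq[OF B] by (simp only: mult_ac)
        finally have small: "(\<beta> / 2 + L * c1 / 6) * (c1 * G) \<le> 3 / 4 * (c0 / (c1 * K))"
          by (simp only: \<gamma>_def)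
        have "q \<le> \<bar>g x ?G (?T ?G)\<bar> + \<bar>g x ?G (rhess A g f x ?G)\<bar>"
          unfolding q_def by (simp add: bilinear_rsub[OF bl])
        also have "\<dots> \<le> \<beta> * G * G\<^sup>2 + Ch * G\<^sup>2"
          using T[of ?G] elim(1) by (simp add: G_def)
        also have "\<beta> * G * G\<^sup>2 \<le> \<beta> * 1 * G\<^sup>2"
          using b(1) c by (intro mult_right_mono mult_left_mono) auto
        finally have "q \<le> (Ch + \<beta>) * G\<^sup>2" by (simp add: algebra_simps)
        also have "\<dots> \<le> K * G\<^sup>2" by (intro mult_right_mono) (auto simp: K_def)
        finally have q: "q \<le> K * G\<^sup>2" .
        have D: "c0 * G * (if q = 0 then \<Delta> else min \<Delta> (G ^ 3 / q)) \<le> D"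
          using step unfolding tr_step_def Let_def G_def q_def D_def by blast
        have Deq: "D = - g x s ?G - 1 / 2 * g x s (H s)"
          by (simp add: D_def tr_model_def bilinear_lzero[OF bl])
        have "f (R x s) - f x - g x s ?G - 1 / 2 * g x s (rhess A g f x s) \<le> L / 6 * t ^ 3"
          using elim(3) t(3) b(3) by (simp add: t_def)
        \<comment> \<open>Replaces the Hessian of the Taylor bound by the \<open>H\<close> of the
          model, at the price allowed by the bound on \<open>tonorm\<close>.\<close>
        moreover have "g x s (H s) - g x s (rhess A g f x s) \<ge> - (\<beta> * G * t\<^sup>2)"
          using T[of s] by (simp add: t_def bilinear_rsub[OF bl] abs_le_iff)
        ultimately have F: "D - 1 / 2 * \<beta> * G * t\<^sup>2 - L / 6 * t ^ 3 \<le> F"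
          unfolding F_def Deq by simp
        have \<Delta>: "\<Delta> > 0" using step by (simp add: tr_step_def)
        note dec = actual_decrease_ge[OF K G(1) \<Delta> t c(2,3,1) L _ q D F small]
        have D1: "c0 * G * min \<Delta> (G / K) \<le> D" "D / 4 \<le> F" "\<gamma> * G * t \<le> D"
          using dec by (simp_all add: q_def \<gamma>_def)
        have "\<gamma> * G * t \<ge> 0" using \<gamma> G t by simp
        then have D0: "D \<ge> 0" using D1(3) by simp
        have "tr_ratio A g f R x H s = (if D = 0 then 1 else F / D)"
          by (simp add: tr_ratio_def D_def F_def Let_def)
        \<comment> \<open>For \<open>D = 0\<close> the ratio has the default value 1, also above the
          threshold.\<close>
        then have ratio: "tr_ratio A g f R x H s \<ge> 1 / 4"
          using D0 D1(2) by (simp add: pos_le_divide_eq)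
        have disp: "R x s \<in> fst d" "norm (snd d (R x s) - snd d x) \<le> CR * t"
          using elim(2) t(3) b(2) by (simp_all add: t_def)
        have "CR * t \<le> e / 2" using b(4) t(3) CR(1) by (meson mult_left_mono less_imp_le order_trans)
        moreover have "norm (snd d (R x s) - snd d xbar)
            \<le> norm (snd d (R x s) - snd d x) + norm (snd d x - snd d xbar)"
          using norm_triangle_ineq[of "snd d (R x s) - snd d x" "snd d x - snd d xbar"] by simp
        ultimately have "norm (snd d (R x s) - snd d xbar) \<le> e"
          using disp(2) elim(5) by linarith
        then have low: "f xbar \<le> f (R x s)" using e(2) disp(1) by blast
        have "t \<le> 2 / (\<gamma> / 4 * sqrt (2 * \<mu>)) * (sqrt (f x - f xbar) - sqrt (f (R x s) - f xbar))"
        proof (rule step_le_sqrt_diff[OF _ t(1) G(1) _ PL(2) _ _ t(3)])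
          show "\<gamma> / 4 * G * t \<le> f x - f xbar - (f (R x s) - f xbar)"
            using D1(2,3) by (simp add: F_def)
          show "f x - f xbar \<le> 1 / (2 * \<mu>) * G\<^sup>2" using elim(6) by (simp add: G_def)
        qed (use low \<gamma> in auto)
        then have "CR * t \<le> C * (sqrt (f x - f xbar) - sqrt (f (R x s) - f xbar))"
          using CR(1) unfolding C_def mult.assoc by (intro mult_left_mono) auto
        then have "norm (snd d (R x s) - snd d x) \<le> C * (sqrt (f x - f xbar) - sqrt (f (R x s) - f xbar))"
          using disp(2) by linarith
        moreover have "c0 / 4 * G * min \<Delta> (G / K) \<le> f x - f (R x s)"
          using D1(1,2) by (simp add: F_def)
        ultimately show "tr_ratio A g f R x H s \<ge> 1 / 4 \<and> R x s \<in> fst d \<and> f xbar \<le> f (R x s) \<and>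
           c0 / 4 * gnorm x * min \<Delta> (gnorm x / K) \<le> f x - f (R x s) \<and>
           norm (snd d (R x s) - snd d x) \<le> C * (sqrt (f x - f xbar) - sqrt (f (R x s) - f xbar))"
          using ratio disp(1) low by (simp add: G_def)
      qed
    qed
  qed
qed

end


section \<open>Convergence\<close>

lemma tr_radius_pos:
  assumes "tr_run A g f R \<rho>' \<Delta>bar x \<Delta> H s" "\<Delta>bar > 0"
  shows "0 < \<Delta> k"
proof (induction k)
  case 0
  then show ?case using assms by (simp add: tr_run_def)
next
  case (Suc k)
  have "\<Delta> (Suc k) \<in> {1 / 4 * \<Delta> k, min (2 * \<Delta> k) \<Delta>bar, \<Delta> k}"
    using assms(1) by (auto simp: tr_run_def Let_def)
  then show ?case using Suc assms(2) by auto
qed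

text \<open>The increments of \<open>z\<close> are dominated by a telescoping series, which
  converges with \<open>p\<close>, so they are absolutely summable.\<close>

lemma telescope_convergent:
  fixes z :: "nat \<Rightarrow> 'e::banach" and p :: "nat \<Rightarrow> real"
  assumes p: "convergent p" and z: "\<And>n. norm (z (Suc n) - z n) \<le> C * (p n - p (Suc n))"
  shows "convergent z"
proof -
  obtain l where "p \<longlonglongrightarrow> l" using p by (auto simp: convergent_def)
  then have "summable (\<lambda>n. C * (p n - p (Suc n)))"
    by (intro summable_mult telescope_summable')
  then have "summable (\<lambda>n. z (Suc n) - z n)"
    by (rule summable_comparison_test[rotated]) (use z in auto)
  then have "(\<lambda>n. \<Sum>i<n. z (Suc i) - z i) \<longlonglongrightarrow> (\<Sum>n. z (Suc n) - z n)"
    by (rule summable_LIMSEQ)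
  then have "(\<lambda>n. z n - z 0) \<longlonglongrightarrow> (\<Sum>n. z (Suc n) - z n)" by (simp add: sum_lessThan_telescope)
  from tendsto_add[OF this tendsto_const[of "z 0"]] show ?thesis by (auto simp: convergent_def)
qed

theorem proposition4p11:
  fixes A :: "('m::{t2_space,second_countable_topology}, 'e::euclidean_space) chart set"
    and g :: "'m \<Rightarrow> 'e \<Rightarrow> 'e \<Rightarrow> real"
    and f :: "'m \<Rightarrow> real"
    and R :: "'m \<Rightarrow> 'e \<Rightarrow> 'm"
    and xbar :: 'm
    and \<mu> L\<^sub>H \<rho>' \<Delta>bar \<beta>\<^sub>H c\<^sub>0 c\<^sub>1 :: real
    and W U :: "'m set"
  assumes "riemannian_manifold A g"
    and "C2_function A f"
    and "is_retraction A R"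
    and "xbar \<in> local_minima f"
    and "\<mu> > 0"
    and "PL_around A g f \<mu> xbar"
    and "L\<^sub>H \<ge> 0"
    and "\<exists>\<delta>>0. \<forall>\<^sub>F x in nhds xbar. \<forall>s. tnorm g x s \<le> \<delta> \<longrightarrow>
           f (R x s) - f x - g x s (rgrad A g f x) - 1 / 2 * g x s (rhess A g f x s)
             \<le> L\<^sub>H / 6 * tnorm g x s ^ 3"
    and "0 < \<rho>'" and "\<rho>' < 1 / 4"
    and "\<Delta>bar > 0"
    and "\<beta>\<^sub>H \<ge> 0" and "c\<^sub>0 > 0" and "c\<^sub>1 \<ge> 0"
    and "xbar \<in> interior W"
    and "xbar \<in> interior U"
  shows "\<exists>V. V \<subseteq> U \<and> xbar \<in> interior V \<and>
    (\<forall>x \<Delta> H s.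
       tr_run A g f R \<rho>' \<Delta>bar x \<Delta> H s \<longrightarrow>
       (\<forall>k. x k \<in> W \<longrightarrow>
          tonorm g (x k) (\<lambda>v. H k v - rhess A g f (x k) v) \<le> \<beta>\<^sub>H * tnorm g (x k) (rgrad A g f (x k))) \<longrightarrow>
       (\<forall>k. let G = rgrad A g f (x k); q = \<bar>g (x k) G (H k G)\<bar> in
          tr_model A g f (x k) (H k) 0 - tr_model A g f (x k) (H k) (s k)
            \<ge> c\<^sub>0 * tnorm g (x k) G *
               (if q = 0 then \<Delta> k else min (\<Delta> k) (tnorm g (x k) G ^ 3 / q))) \<longrightarrow>
       (\<forall>k. x k \<in> W \<longrightarrow> tnorm g (x k) (s k) \<le> c\<^sub>1 * tnorm g (x k) (rgrad A g f (x k))) \<longrightarrow>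
       (\<forall>K. x K \<in> V \<longrightarrow>
          (\<forall>k\<ge>K. x k \<in> U) \<and> (\<exists>xinf \<in> U \<inter> local_minima f. x \<longlonglongrightarrow> xinf)))"
proof -
  interpret riemannian_C2_function A g f using assms(1,2) by unfold_locales
  define d where "d = chart_at A xbar"
  define y0 where "y0 = snd d xbar"
  \<comment> \<open>The local analysis divides by this constant, while \<open>c\<^sub>1\<close> may
    be 0; a larger constant only weakens the bound on the steps.\<close>
  define c where "c = c\<^sub>1 + 1"
  have d: "d \<in> A" and xd: "xbar \<in> fst d" using chart_at by (auto simp: d_def)
  have c: "c \<ge> 1" "c\<^sub>1 \<le> c" using \<open>c\<^sub>1 \<ge> 0\<close> by (simp_all add: c_def)
  obtain C a K0 where C: "C > 0" and a: "a > 0" and K0: "K0 > 0" and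
    step: "\<forall>\<^sub>F x in nhds xbar. \<forall>\<Delta> H s. tr_step \<beta>\<^sub>H c\<^sub>0 c x \<Delta> H s \<longrightarrow>
       tr_ratio A g f R x H s \<ge> 1 / 4 \<and> R x s \<in> fst d \<and> f xbar \<le> f (R x s) \<and>
       a * gnorm x * min \<Delta> (gnorm x / K0) \<le> f x - f (R x s) \<and>
       norm (snd d (R x s) - snd d x) \<le> C * (sqrt (f x - f xbar) - sqrt (f (R x s) - f xbar))"
    using tr_step_local[OF assms(3,4,6,5,7,8) \<open>\<beta>\<^sub>H \<ge> 0\<close> \<open>c\<^sub>0 > 0\<close> c(1) d xd] by blast
  \<comment> \<open>Every point near \<open>xbar\<close> has a whole neighbourhood on which
    \<open>f\<close> is at least \<open>f xbar\<close>. A limit of iterates with value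
    \<open>f xbar\<close> is then itself a local minimum.\<close>
  have low: "\<forall>\<^sub>F x in nhds xbar. \<forall>\<^sub>F y in nhds x. f xbar \<le> f y"
    using \<open>xbar \<in> local_minima f\<close> by (simp add: local_minima_def eventually_eventually)
  have "\<forall>\<^sub>F x in nhds xbar. x \<in> interior U \<inter> interior W"
    using assms(15,16) by (intro eventually_nhds_in_open) auto
  with step low assms(6)[unfolded PL_around_def]
  have "\<forall>\<^sub>F x in nhds xbar. x \<in> interior U \<inter> interior W \<and> (\<forall>\<^sub>F y in nhds x. f xbar \<le> f y) \<and>
     f x - f xbar \<le> 1 / (2 * \<mu>) * (gnorm x)\<^sup>2 \<and> (\<forall>\<Delta> H s. tr_step \<beta>\<^sub>H c\<^sub>0 c x \<Delta> H s \<longrightarrow>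
       tr_ratio A g f R x H s \<ge> 1 / 4 \<and> R x s \<in> fst d \<and> f xbar \<le> f (R x s) \<and>
       a * gnorm x * min \<Delta> (gnorm x / K0) \<le> f x - f (R x s) \<and>
       norm (snd d (R x s) - snd d x) \<le> C * (sqrt (f x - f xbar) - sqrt (f (R x s) - f xbar)))"
    by eventually_elim blast
  from eventually_chart_cball[OF d xd this, folded y0_def]
  obtain r where r: "r > 0" and ball: "cball y0 r \<subseteq> snd d ` fst d" and
    near: "\<And>x. x \<in> fst d \<Longrightarrow> norm (snd d x - y0) \<le> r \<Longrightarrow>
      x \<in> interior U \<inter> interior W \<and> (\<forall>\<^sub>F y in nhds x. f xbar \<le> f y) \<and>
      f x - f xbar \<le> 1 / (2 * \<mu>) * (gnorm x)\<^sup>2 \<and> (\<forall>\<Delta> H s. tr_step \<beta>\<^sub>H c\<^sub>0 c x \<Delta> H s \<longrightarrow>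
       tr_ratio A g f R x H s \<ge> 1 / 4 \<and> R x s \<in> fst d \<and> f xbar \<le> f (R x s) \<and>
       a * gnorm x * min \<Delta> (gnorm x / K0) \<le> f x - f (R x s) \<and>
       norm (snd d (R x s) - snd d x) \<le> C * (sqrt (f x - f xbar) - sqrt (f (R x s) - f xbar)))"
    by (metis (lifting))
  \<comment> \<open>One half of \<open>r\<close> is for the distance of the entering iterate from
    \<open>y0\<close>, the other for the length of the path that remains.\<close>
  define V where "V = {x \<in> fst d. norm (snd d x - y0) < r / 2 \<and> C * sqrt (f x - f xbar) < r / 2}"
  have f_cont: "isCont (f \<circ> chart_inv d) y" if "y \<in> snd d ` fst d" for y
    using function_differentiable[OF d that] by (rule differentiable_imp_continuous_within)
  have f_lim: "((\<lambda>n. f (z n)) \<longlongrightarrow> f (chart_inv d y)) G"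
    if "\<forall>\<^sub>F n in G. z n \<in> fst d" "((\<lambda>n. snd d (z n)) \<longlongrightarrow> y) G" "y \<in> snd d ` fst d" for z y G
  proof (rule Lim_transform_eventually)
    show "((\<lambda>n. (f \<circ> chart_inv d) (snd d (z n))) \<longlongrightarrow> f (chart_inv d y)) G"
      using isCont_tendsto_compose[OF f_cont[OF that(3)] that(2)] by simp
    show "\<forall>\<^sub>F n in G. (f \<circ> chart_inv d) (snd d (z n)) = f (z n)"
      using that(1) by eventually_elim (simp add: chart_inv_chart[OF d])
  qed
  have VU: "V \<subseteq> U" using near r interior_subset unfolding V_def by fastforce
  have Vint: "xbar \<in> interior V"
  proof -
    have dom: "\<forall>\<^sub>F x in nhds xbar. x \<in> fst d"
      using open_chart_domain[OF d] xd by (rule eventually_nhds_in_open)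
    have lim: "(snd d \<longlongrightarrow> y0) (nhds xbar)" unfolding y0_def by (rule tendsto_chart[OF d xd])
    have "((\<lambda>x. f x) \<longlongrightarrow> f (chart_inv d y0)) (nhds xbar)"
      using dom lim xd by (intro f_lim) (auto simp: y0_def)
    then have "((\<lambda>x. C * sqrt (f x - f xbar)) \<longlongrightarrow> C * sqrt (f xbar - f xbar)) (nhds xbar)"
      by (intro tendsto_intros) (simp add: y0_def chart_inv_chart[OF d xd])
    then have "\<forall>\<^sub>F x in nhds xbar. C * sqrt (f x - f xbar) < r / 2"
      using r by (intro order_tendstoD) auto
    moreover have "((\<lambda>x. norm (snd d x - y0)) \<longlongrightarrow> norm (y0 - y0)) (nhds xbar)"
      by (intro tendsto_intros lim)
    then have "\<forall>\<^sub>F x in nhds xbar. norm (snd d x - y0) < r / 2"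
      using r by (intro order_tendstoD) auto
    ultimately have "\<forall>\<^sub>F x in nhds xbar. x \<in> V"
      using dom by eventually_elim (simp add: V_def)
    then show ?thesis by (auto simp: eventually_nhds interior_def)
  qed
  have main: "(\<forall>k\<ge>K. x k \<in> U) \<and> (\<exists>xinf \<in> U \<inter> local_minima f. x \<longlonglongrightarrow> xinf)"
    if run: "tr_run A g f R \<rho>' \<Delta>bar x \<Delta> H s"
      and Happrox: "\<forall>k. x k \<in> W \<longrightarrow>
          tonorm g (x k) (\<lambda>v. H k v - rhess A g f (x k) v) \<le> \<beta>\<^sub>H * gnorm (x k)"
      and Cauchy: "\<forall>k. let G = rgrad A g f (x k); q = \<bar>g (x k) G (H k G)\<bar> in
          tr_model A g f (x k) (H k) 0 - tr_model A g f (x k) (H k) (s k)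
            \<ge> c\<^sub>0 * tnorm g (x k) G *
               (if q = 0 then \<Delta> k else min (\<Delta> k) (tnorm g (x k) G ^ 3 / q))"
      and steps: "\<forall>k. x k \<in> W \<longrightarrow> tnorm g (x k) (s k) \<le> c\<^sub>1 * gnorm (x k)"
      and K: "x K \<in> V" for x \<Delta> H s K
  proof -
    define p where "p k = sqrt (f (x k) - f xbar)" for k
    have \<Delta>pos: "\<Delta> k > 0" for k using tr_radius_pos[OF run \<open>\<Delta>bar > 0\<close>] .
    have one: "tr_step \<beta>\<^sub>H c\<^sub>0 c (x k) (\<Delta> k) (H k) (s k)" if "x k \<in> interior W" for k
    proof -
      have W: "x k \<in> W" using that interior_subset by blast
      have "tnorm g (x k) (s k) \<le> c * gnorm (x k)"
        using steps W mult_right_mono[OF c(2) tnorm_nonneg] by (meson order_trans)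
      then show ?thesis
        using run Happrox Cauchy W \<Delta>pos[of k] unfolding tr_step_def tr_run_def Let_def by blast
    qed
    have next_iterate: "x (Suc k) \<in> fst d" "f xbar \<le> f (x (Suc k))" "min (\<Delta> k) \<Delta>bar \<le> \<Delta> (Suc k)"
      "a * gnorm (x k) * min (\<Delta> k) (gnorm (x k) / K0) \<le> f (x k) - f (x (Suc k))"
      "norm (snd d (x (Suc k)) - snd d (x k)) \<le> C * (p k - p (Suc k))"
      if k: "x k \<in> fst d" "norm (snd d (x k) - y0) \<le> r" for k
    proof -
      have ts: "tr_step \<beta>\<^sub>H c\<^sub>0 c (x k) (\<Delta> k) (H k) (s k)" using near[OF k] by (intro one) simp
      have ratio: "tr_ratio A g f R (x k) (H k) (s k) \<ge> 1 / 4" using near[OF k] ts by blast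
      then have xS: "x (Suc k) = R (x k) (s k)"
        using run \<open>\<rho>' < 1 / 4\<close> by (auto simp: tr_run_def Let_def)
      \<comment> \<open>The initial radius may exceed \<open>\<Delta>bar\<close>, and then even a
        very good step can reduce the radius to \<open>\<Delta>bar\<close>; hence the minimum on the
        left.\<close>
      show "min (\<Delta> k) \<Delta>bar \<le> \<Delta> (Suc k)"
        using run ratio \<Delta>pos[of k] by (auto simp: tr_run_def Let_def)
      show "x (Suc k) \<in> fst d" "f xbar \<le> f (x (Suc k))"
        "a * gnorm (x k) * min (\<Delta> k) (gnorm (x k) / K0) \<le> f (x k) - f (x (Suc k))"
        "norm (snd d (x (Suc k)) - snd d (x k)) \<le> C * (p k - p (Suc k))"
        using near[OF k] ts unfolding xS p_def by blast+
    qed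
    have xK: "x K \<in> fst d" "norm (snd d (x K) - y0) < r / 2" "C * p K < r / 2"
      using K by (auto simp: V_def p_def)
    \<comment> \<open>Not part of the definition of \<open>V\<close>: it comes from the eventual
      bound around \<open>x K\<close>, evaluated at \<open>x K\<close> itself.\<close>
    have lowK: "f xbar \<le> f (x K)"
      using near[of "x K"] xK r eventually_nhds_x_imp_x by fastforce
    define Dmin where "Dmin = min (\<Delta> K) \<Delta>bar"
    have Dmin: "Dmin > 0" using \<Delta>pos \<open>\<Delta>bar > 0\<close> by (simp add: Dmin_def)
    \<comment> \<open>Displacements are measured from the entering iterate, so the bounds telescope
      to \<open>C * (p K - p k) \<le> C * p K < r / 2\<close>, which keeps every iterate in the ball
      where the local facts hold.\<close>
    have inv: "x k \<in> fst d \<and> f xbar \<le> f (x k) \<and> norm (snd d (x k) - snd d (x K)) \<le> C * (p K - p k) \<and>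
        Dmin \<le> \<Delta> k \<and> norm (snd d (x k) - y0) \<le> r" if "k \<ge> K" for k
      using that
    proof (induction k rule: dec_induct)
      case base
      then show ?case using xK lowK r by (auto simp: Dmin_def)
    next
      case (step k)
      then have k: "x k \<in> fst d" "norm (snd d (x k) - y0) \<le> r" by auto
      note n = next_iterate[OF k]
      have "norm (snd d (x (Suc k)) - snd d (x K))
          \<le> norm (snd d (x (Suc k)) - snd d (x k)) + norm (snd d (x k) - snd d (x K))"
        using norm_triangle_ineq[of "snd d (x (Suc k)) - snd d (x k)" "snd d (x k) - snd d (x K)"] by simp
      also have "\<dots> \<le> C * (p k - p (Suc k)) + C * (p K - p k)"
        using step.IH n(5) by (intro add_mono) auto
      finally have dist: "norm (snd d (x (Suc k)) - snd d (x K)) \<le> C * (p K - p (Suc k))"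
        by (simp add: algebra_simps)
      have "p (Suc k) \<ge> 0" using n(2) by (simp add: p_def)
      then have "C * p (Suc k) \<ge> 0" using C by simp
      then have "C * (p K - p (Suc k)) < r / 2" using xK(3) unfolding right_diff_distrib by linarith
      moreover have "norm (snd d (x (Suc k)) - y0)
          \<le> norm (snd d (x (Suc k)) - snd d (x K)) + norm (snd d (x K) - y0)"
        using norm_triangle_ineq[of "snd d (x (Suc k)) - snd d (x K)" "snd d (x K) - y0"] by simp
      ultimately have "norm (snd d (x (Suc k)) - y0) \<le> r" using dist xK(2) by linarith
      moreover have "Dmin \<le> min (\<Delta> k) \<Delta>bar" using step.IH by (simp add: Dmin_def)
      then have "Dmin \<le> \<Delta> (Suc k)" using n(3) by (rule order_trans)
      ultimately show ?case using n(1,2) dist by blast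
    qed
    have inU: "x k \<in> U" if "k \<ge> K" for k
      using near[of "x k"] inv[OF that] interior_subset by blast
    define w where "w n = x (n + K)" for n
    define P where "P n = p (n + K)" for n
    have w: "w n \<in> fst d" "f xbar \<le> f (w n)" "Dmin \<le> \<Delta> (n + K)" "norm (snd d (w n) - y0) \<le> r"
      "norm (snd d (w (Suc n)) - snd d (w n)) \<le> C * (P n - P (Suc n))"
      "a * gnorm (w n) * min Dmin (gnorm (w n) / K0) \<le> f (w n) - f (w (Suc n))" for n
    proof -
      note i = inv[of "n + K", simplified]
      show "w n \<in> fst d" "f xbar \<le> f (w n)" "Dmin \<le> \<Delta> (n + K)" "norm (snd d (w n) - y0) \<le> r"
        using i by (simp_all add: w_def)
      have k: "x (n + K) \<in> fst d" "norm (snd d (x (n + K)) - y0) \<le> r" using i by auto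
      show "norm (snd d (w (Suc n)) - snd d (w n)) \<le> C * (P n - P (Suc n))"
        using next_iterate(5)[OF k] by (simp add: w_def P_def)
      have "a * gnorm (w n) * min Dmin (gnorm (w n) / K0) \<le> a * gnorm (w n) * min (\<Delta> (n + K)) (gnorm (w n) / K0)"
        using i a tnorm_nonneg by (intro mult_left_mono min.mono) auto
      also have "\<dots> \<le> f (w n) - f (w (Suc n))" using next_iterate(4)[OF k] by (simp add: w_def)
      finally show "a * gnorm (w n) * min Dmin (gnorm (w n) / K0) \<le> f (w n) - f (w (Suc n))" .
    qed
    have Psq: "(P n)\<^sup>2 = f (w n) - f xbar" and P0: "P n \<ge> 0" for n
      using w(2)[of n] by (simp_all add: P_def p_def w_def)
    \<comment> \<open>A norm is nonnegative, so the displacement bound by itself makes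
      \<open>P\<close> decreasing.\<close>
    have "C * (P n - P (Suc n)) \<ge> 0" for n using w(5)[of n] norm_ge_zero order_trans by blast
    then have "P (Suc n) \<le> P n" for n using C by (simp add: zero_le_mult_iff)
    then have "decseq P" by (simp add: decseq_Suc_iff)
    then obtain l where l: "P \<longlonglongrightarrow> l" "\<And>n. l \<le> P n"
      using decseq_convergent[of P 0] P0 by blast
    then have "convergent P" by (auto simp: convergent_def)
    from telescope_convergent[OF this w(5)]
    obtain yinf where yinf: "(\<lambda>n. snd d (w n)) \<longlonglongrightarrow> yinf" by (auto simp: convergent_def)
    have "yinf \<in> cball y0 r"
    proof (rule closed_sequentially[OF closed_cball _ yinf])
      show "snd d (w n) \<in> cball y0 r" for n
        using w(4)[of n] by (simp add: dist_norm norm_minus_commute)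
    qed
    then have yim: "yinf \<in> snd d ` fst d" and ynorm: "norm (yinf - y0) \<le> r"
      using ball by (auto simp: dist_norm norm_minus_commute)
    define xinf where "xinf = chart_inv d yinf"
    have xinf: "xinf \<in> fst d" "snd d xinf = yinf"
      using chart_inv_in_domain[OF d yim] chart_chart_inv[OF d yim] by (simp_all add: xinf_def)
    have "isCont (chart_inv d) yinf"
      using continuous_on_chart_inv[OF d] yim
      unfolding continuous_on_eq_continuous_at[OF open_chart_image[OF d]] by blast
    then have "(\<lambda>n. chart_inv d (snd d (w n))) \<longlonglongrightarrow> xinf"
      unfolding xinf_def by (rule isCont_tendsto_compose) (rule yinf)
    then have "w \<longlonglongrightarrow> xinf" by (simp add: chart_inv_chart[OF d w(1)])
    then have conv: "x \<longlonglongrightarrow> xinf" unfolding w_def by (rule LIMSEQ_offset)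
    have l0: "l \<ge> 0" using LIMSEQ_le_const[OF l(1)] P0 by blast
    \<comment> \<open>Otherwise the Polyak-Lojasiewicz inequality would keep the gradient norm above
      \<gamma>, and every step would decrease \<open>f\<close> by at least \<eta>, although these
      decreases tend to 0.\<close>
    have "l = 0"
    proof (rule ccontr)
      assume "l \<noteq> 0"
      then have lp: "l > 0" using l0 by simp
      define \<gamma> where "\<gamma> = sqrt (2 * \<mu>) * l"
      have \<gamma>: "\<gamma> > 0" using lp \<open>\<mu> > 0\<close> by (simp add: \<gamma>_def)
      define \<eta> where "\<eta> = a * \<gamma> * min Dmin (\<gamma> / K0)"
      have \<eta>: "\<eta> > 0" using a \<gamma> Dmin K0 by (simp add: \<eta>_def)
      have le: "\<eta> \<le> (P n)\<^sup>2 - (P (Suc n))\<^sup>2" for n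
      proof -
        have "l\<^sup>2 \<le> (P n)\<^sup>2" using l(2) l0 by (intro power_mono)
        also have "\<dots> \<le> 1 / (2 * \<mu>) * (gnorm (w n))\<^sup>2" using near[OF w(1,4), of n] by (simp add: Psq)
        finally have "2 * \<mu> * l\<^sup>2 \<le> (gnorm (w n))\<^sup>2" using \<open>\<mu> > 0\<close> by (simp add: field_simps)
        then have "\<gamma>\<^sup>2 \<le> (gnorm (w n))\<^sup>2" using \<open>\<mu> > 0\<close> by (simp add: \<gamma>_def power_mult_distrib)
        then have \<gamma>le: "\<gamma> \<le> gnorm (w n)" using tnorm_nonneg by (rule power2_le_imp_le)
        then have "\<eta> \<le> a * gnorm (w n) * min Dmin (gnorm (w n) / K0)"
          unfolding \<eta>_def using a \<gamma> Dmin K0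
          by (intro mult_mono min.mono divide_right_mono) auto
        also have "\<dots> \<le> (P n)\<^sup>2 - (P (Suc n))\<^sup>2" using w(6)[of n] by (simp add: Psq)
        finally show ?thesis .
      qed
      have "(\<lambda>n. (P n)\<^sup>2 - (P (Suc n))\<^sup>2) \<longlonglongrightarrow> l\<^sup>2 - l\<^sup>2"
        by (intro tendsto_intros l(1) LIMSEQ_Suc)
      then have "\<eta> \<le> l\<^sup>2 - l\<^sup>2" by (rule LIMSEQ_le_const) (use le in auto)
      then show False using \<eta> by simp
    qed
    \<comment> \<open>Continuity of \<open>f\<close> identifies the limit of the squared
      \<open>P n\<close> with the gap at \<open>xinf\<close>, which is therefore 0.\<close>
    have "(\<lambda>n. (P n)\<^sup>2) \<longlonglongrightarrow> l\<^sup>2" by (intro tendsto_intros l(1))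
    moreover have "(\<lambda>n. (P n)\<^sup>2) \<longlonglongrightarrow> f xinf - f xbar"
      unfolding xinf_def Psq by (intro tendsto_intros f_lim yinf yim) (simp add: w(1))
    ultimately have "l\<^sup>2 = f xinf - f xbar" by (rule LIMSEQ_unique)
    then have fx: "f xinf = f xbar" using \<open>l = 0\<close> by simp
    have ninf: "xinf \<in> interior U" "\<forall>\<^sub>F y in nhds xinf. f xbar \<le> f y"
      using near[of xinf] xinf ynorm by auto
    then have "xinf \<in> U \<inter> local_minima f"
      using interior_subset by (auto simp: local_minima_def fx)
    then show ?thesis using inU conv by blast
  qed
  show ?thesis
    by (intro exI[of _ V] conjI[OF VU] conjI[OF Vint] allI impI) (rule main; assumption)
qed

end
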